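(* Let $n\ge 2$, let $(R,J,a)$ be a Riesz triple on the unit sphere $S_n$ of $\mathbb{C}^n$, with $R=\{R_j\}_{j=1}^\infty$, $J=\{j_k\}_{k=1}^\infty$, $a=\{a_k\}_{k=1}^\infty$, and let $\Pi(R,J,a)$ be the corresponding Riesz product. Then \[ \dim_{\mathcal H}\Pi(R,J,a)\ \ge\ 2n-1-\alpha_0, \] where \[ \alpha_0=\max\left[0,\ \limsup_{k\to\infty}\left(\frac{\log\frac{|a_k|^2}{2}+\sum_{\ell=1}^{k-1}\log\left(1+\frac{|a_\ell|^2}{2}\right)}{\log j_k}\right)\right]. \]
   Context: Let $n\ge 2$, $S=S_n=\{\zeta\in\mathbb{C}^n:|\zeta|=1\}$ with the Euclidean metric, and let $\sigma$ be the normalized Lebesgue (rotation-invariant probability) measure on $S$; $L^p(S)=L^p(\sigma)$. $H(j,0)$ is the space of (restrictions to $S$ of) homogeneous holomorphic polynomials of degree $j$ in $z_1,\dots,z_n$. A Ryll--Wojtaszczyk sequence with constant $\delta\in(0,1)$ is a sequence $\{R_j\}_{j=1}^\infty$ such that, for all $j=1,2,\dots$: $R_j\in H(j,0)$, $\|R_j\|_{L^\infty(S)}=1$, and $\|R_j\|_{L^2(S)}\ge\delta$. A Riesz triple $(R,J,a)$ consists of a Ryll--Wojtaszczyk sequence $R=\{R_j\}_{j=1}^\infty$ (with some constant $\delta\in(0,1)$), a sequence $J=\{j_k\}_{k=1}^\infty$ of positive integers with $j_{k+1}/j_k\ge 3$ for all $k$, and a sequence $a=\{a_k\}_{k=1}^\infty$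 in the open unit disk $\mathbb{D}\subset\mathbb{C}$. The Riesz product \[ \Pi(R,J,a)=\prod_{k=1}^\infty\left(\frac{\overline{a}_k\overline{R}_{j_k}}{2}+1+\frac{a_kR_{j_k}}{2}\right) \] is the probability measure on $S$ that is the weak*-limit, as $N\to\infty$, of the measures $\prod_{k=1}^N\left(\frac{\overline{a}_k\overline{R}_{j_k}}{2}+1+\frac{a_kR_{j_k}}{2}\right)\sigma$ (this limit is known to exist). For a finite positive Borel measure $\mu$ on $S$, its Hausdorff dimension is $\dim_{\mathcal H}\mu=\inf\{\dim_{\mathcal H}E: E\subset S \text{ Borel},\ \mu(E)>0\}$, where $\dim_{\mathcal H}E$ is the Hausdorff dimension of the set $E$. Convention: $\log 0=-\infty$ (relevant when some $a_k=0$). *)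

theory Defs
  imports "HOL-Probability.Probability"
begin

(* complex ^ 'n carries the Euclidean norm and metric, so sphere 0 1 is the unit sphere of C^n,
   n = CARD('n). *)
abbreviation usphere :: "(complex ^ 'n::finite) set" where
  "usphere \<equiv> sphere 0 1"

(* The normalized Lebesgue measure as cone measure: sigma(E) is the proportion of the unit ball
   occupied by {r *R z | z in E, 0 < r < 1}. Here sgn x = x /R norm x is the radial projection;
   its value at the single point 0 lies off the sphere, but {0} is a null set. *)
definition sphere_measure :: "(complex ^ 'n::finite) measure" where
  "sphere_measure =
     restrict_space (distr (uniform_measure lborel (ball 0 1)) borel sgn) usphere"

definition multi_indices :: "nat \<Rightarrow> ('n::finite \<Rightarrow> nat) set" where
  "multi_indices j = {\<alpha>. (\<Sum>i\<in>UNIV. \<alpha> i) = j}"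

(* H(j,0). Only values on the sphere matter: an element of H(j,0) is represented by any function
   on C^n whose restriction to the sphere is that of a homogeneous polynomial of degree j. *)
definition Hol_homog :: "nat \<Rightarrow> (complex ^ 'n::finite \<Rightarrow> complex) set" where
  "Hol_homog j = {f. \<exists>c. \<forall>z\<in>usphere.
     f z = (\<Sum>\<alpha>\<in>multi_indices j. c \<alpha> * (\<Prod>i\<in>UNIV. (z $ i) ^ \<alpha> i))}"

definition Linfty_norm :: "(complex ^ 'n::finite \<Rightarrow> complex) \<Rightarrow> ereal" where
  "Linfty_norm f = esssup sphere_measure (\<lambda>z. ereal (cmod (f z)))"

definition L2_norm :: "(complex ^ 'n::finite \<Rightarrow> complex) \<Rightarrow> real" where
  "L2_norm f = sqrt (LINT z|sphere_measure. (cmod (f z))\<^sup>2)"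

(* All sequences below are indexed from 1; their values at index 0 are irrelevant. *)
definition RW_sequence :: "real \<Rightarrow> (nat \<Rightarrow> complex ^ 'n::finite \<Rightarrow> complex) \<Rightarrow> bool" where
  "RW_sequence \<delta> R \<longleftrightarrow>
     (\<forall>j\<ge>1. R j \<in> Hol_homog j \<and> Linfty_norm (R j) = 1 \<and> L2_norm (R j) \<ge> \<delta>)"

definition Riesz_triple ::
  "(nat \<Rightarrow> complex ^ 'n::finite \<Rightarrow> complex) \<Rightarrow> (nat \<Rightarrow> nat) \<Rightarrow> (nat \<Rightarrow> complex) \<Rightarrow> bool" where
  "Riesz_triple R J a \<longleftrightarrow>
     (\<exists>\<delta>. 0 < \<delta> \<and> \<delta> < 1 \<and> RW_sequence \<delta> R) \<and>
     (\<forall>k\<ge>1. J k > 0) \<and>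
     (\<forall>k\<ge>1. real (J (Suc k)) / real (J k) \<ge> 3) \<and>
     (\<forall>k\<ge>1. cmod (a k) < 1)"

definition Riesz_partial ::
  "(nat \<Rightarrow> complex ^ 'n::finite \<Rightarrow> complex) \<Rightarrow> (nat \<Rightarrow> nat) \<Rightarrow> (nat \<Rightarrow> complex) \<Rightarrow> nat
     \<Rightarrow> complex ^ 'n \<Rightarrow> complex" where
  "Riesz_partial R J a N z =
     (\<Prod>k=1..N. cnj (a k) * cnj (R (J k) z) / 2 + 1 + a k * R (J k) z / 2)"

lemma Riesz_partial_real: "Riesz_partial R J a N z \<in> \<real>"
  unfolding Riesz_partial_def
proof (rule prod_in_Reals)
  fix k
  have "cnj (a k) * cnj (R (J k) z) / 2 + 1 + a k * R (J k) z / 2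
      = complex_of_real (1 + Re (a k * R (J k) z))"
    by (simp add: complex_eq_iff field_simps)
  then show "cnj (a k) * cnj (R (J k) z) / 2 + 1 + a k * R (J k) z / 2 \<in> \<real>"
    by (simp only: Reals_of_real)
qed

(* Re only converts the type: by the preceding lemma the product is real. For a Riesz triple each
   factor is 1 + Re (a_k R_{j_k}), which is positive on the sphere, so ennreal does not truncate. *)
definition Riesz_partial_measure ::
  "(nat \<Rightarrow> complex ^ 'n::finite \<Rightarrow> complex) \<Rightarrow> (nat \<Rightarrow> nat) \<Rightarrow> (nat \<Rightarrow> complex) \<Rightarrow> nat
     \<Rightarrow> (complex ^ 'n) measure" where
  "Riesz_partial_measure R J a N =
     density sphere_measure (\<lambda>z. ennreal (Re (Riesz_partial R J a N z)))"

definition weak_star_limit ::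
  "(nat \<Rightarrow> (complex ^ 'n::finite) measure) \<Rightarrow> (complex ^ 'n) measure \<Rightarrow> bool" where
  "weak_star_limit M \<mu> \<longleftrightarrow>
     (\<forall>f :: complex ^ 'n \<Rightarrow> complex. continuous_on usphere f \<longrightarrow>
        (\<lambda>N. LINT z|M N. f z) \<longlonglongrightarrow> (LINT z|\<mu>. f z))"

(* The Riesz product is described by its defining property; a weak* limit is unique. *)
definition is_Riesz_product ::
  "(nat \<Rightarrow> complex ^ 'n::finite \<Rightarrow> complex) \<Rightarrow> (nat \<Rightarrow> nat) \<Rightarrow> (nat \<Rightarrow> complex)
     \<Rightarrow> (complex ^ 'n) measure \<Rightarrow> bool" where
  "is_Riesz_product R J a \<mu> \<longleftrightarrow>
     prob_space \<mu> \<and> sets \<mu> = sets (restrict_space borel usphere) \<and>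
     weak_star_limit (Riesz_partial_measure R J a) \<mu>"

(* diameter is only meaningful for bounded sets, hence the boundedness condition. *)
definition hausdorff_premeasure :: "real \<Rightarrow> real \<Rightarrow> 'a::metric_space set \<Rightarrow> ennreal" where
  "hausdorff_premeasure s \<delta> E =
     (INF U \<in> {U :: nat \<Rightarrow> 'a set. E \<subseteq> (\<Union>i. U i) \<and> (\<forall>i. bounded (U i) \<and> diameter (U i) \<le> \<delta>)}.
        (\<Sum>i. ennreal (diameter (U i) powr s)))"

definition hausdorff_outer_measure :: "real \<Rightarrow> 'a::metric_space set \<Rightarrow> ennreal" where
  "hausdorff_outer_measure s E = (SUP \<delta>\<in>{0<..}. hausdorff_premeasure s \<delta> E)"

(* Restricting to s > 0 does not change the infimum and avoids the convention for 0 powr 0. *)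
definition hausdorff_dim :: "'a::metric_space set \<Rightarrow> ereal" where
  "hausdorff_dim E = (INF s \<in> {s. s > 0 \<and> hausdorff_outer_measure s E = 0}. ereal s)"

definition hausdorff_dim_measure :: "'a::metric_space measure \<Rightarrow> ereal" where
  "hausdorff_dim_measure \<mu> = (INF E \<in> {E \<in> sets \<mu>. emeasure \<mu> E > 0}. hausdorff_dim E)"

(* The logarithm of a nonnegative real, with log 0 = -infinity. *)
definition elog :: "real \<Rightarrow> ereal" where
  "elog x = (if x = 0 then -\<infinity> else ereal (ln x))"

(* The denominator ln (J k) can vanish only for k \<le> 1, which does not affect the limsup. *)
definition alpha0 :: "(nat \<Rightarrow> nat) \<Rightarrow> (nat \<Rightarrow> complex) \<Rightarrow> ereal" where
  "alpha0 J a = max 0 (limsup (\<lambda>k.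
     (elog ((cmod (a k))\<^sup>2 / 2) + (\<Sum>l=1..<k. elog (1 + (cmod (a l))\<^sup>2 / 2)))
       / ereal (ln (real (J k)))))"

lemma finite_multi_indices: "finite (multi_indices j :: ('n::finite \<Rightarrow> nat) set)"
proof (rule finite_subset)
  show "multi_indices j \<subseteq> (UNIV :: 'n set) \<rightarrow>\<^sub>E {..j}"
    by (auto simp: multi_indices_def intro: member_le_sum)
  show "finite ((UNIV :: 'n set) \<rightarrow>\<^sub>E {..j})"
    by (intro finite_PiE) auto
qed

lemma space_sphere_measure: "space sphere_measure = usphere"
  by (simp add: sphere_measure_def space_restrict_space)

lemma sets_sphere_measure: "sets sphere_measure = sets (restrict_space borel usphere)"
  by (simp add: sphere_measure_def sets_restrict_space)

lemma emeasure_sphere_measure: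
  fixes E :: "(complex ^ 'n::finite) set"
  assumes "E \<in> sets borel" "E \<subseteq> usphere"
  shows "emeasure sphere_measure E =
    emeasure lborel {x \<in> ball 0 1. sgn x \<in> E} / emeasure lborel (ball (0 :: complex ^ 'n) 1)"
proof -
  have sgn [measurable]: "(sgn :: complex ^ 'n \<Rightarrow> _) \<in> borel_measurable borel"
    by (simp add: sgn_div_norm[abs_def])
  have "emeasure sphere_measure E =
    emeasure (uniform_measure lborel (ball 0 1)) (sgn -` E \<inter> UNIV)"
    using assms by (simp add: sphere_measure_def emeasure_restrict_space emeasure_distr)
  also have "\<dots> = emeasure lborel (ball 0 1 \<inter> sgn -` E) / emeasure lborel (ball (0 :: complex ^ 'n) 1)"
    using measurable_sets_borel[OF sgn assms(1)] by simp
  also have "ball 0 1 \<inter> sgn -` E = {x \<in> ball 0 1. sgn x \<in> E}" by auto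
  finally show ?thesis .
qed

lemma prob_space_sphere_measure: "prob_space (sphere_measure :: (complex ^ 'n::finite) measure)"
proof
  let ?B = "ball (0 :: complex ^ 'n) 1"
  have "{x \<in> ?B. sgn x \<in> usphere} = ?B - {0}" by (auto simp: norm_sgn)
  moreover have "emeasure lborel (?B - {0}) = emeasure lborel ?B"
    by (rule emeasure_Diff_null_set) auto
  moreover have "emeasure lborel ?B \<noteq> 0"
    by (simp add: emeasure_ball order_less_imp_not_eq2)
  moreover have "emeasure lborel ?B \<noteq> \<infinity>"
    using emeasure_lborel_ball_finite[of "0 :: complex ^ 'n" 1] by simp
  ultimately show "emeasure (sphere_measure :: (complex ^ 'n) measure) (space sphere_measure) = 1"
    by (simp add: space_sphere_measure emeasure_sphere_measure ennreal_divide_self less_top)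
qed

end

(* Multiplication by unit complex numbers cuts the sphere into circles, and on each of them the
   Riesz product is a classical lacunary Riesz product with coefficients dominated by those of a.
   Averaging over arcs of length 2r in these circles is an L^2(sigma)-bounded operator commuting with
   rotations; by orthogonality of the frequencies it maps the partial products to functions whose
   squared L^2 norm is O(r^(-alpha)), uniformly in N, for every alpha > alpha0. Testing the weak* limit
   against the arc average of a bump function that is 1 near m balls of radius r then gives
   mu(union of m balls of radius r) <= C (m r^(2n-1-alpha))^(1/2) by the Cauchy-Schwarz inequality.
   Sorting a cover by dyadic diameter, one concludes that sets of vanishing s-dimensional Hausdorff
   measure are mu-null as soon as s < 2n-1-alpha. *)
theory Submission
  imports Defs
begin

section \<open>Rotations and the sphere measure\<close>

text \<open>The polynomials are controlled only through their sup norm and homogeneity, so the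
  direction with usable Fourier structure is that of the circles; the other 2n-2 directions enter
  through the volume r^(2n-1) of a ball alone. The partial products need not be uniformly bounded,
  but their Fourier coefficients along circles are dominated, which is why the estimates live in
  L^2. The k-th factor creates frequencies of size comparable to j_k whose squared coefficients add
  up to at most |a_k|^2/2 times the product of 1 + |a_l|^2/2 over l < k, the exponential of the
  numerator in \<open>alpha0\<close>. Averaging at scale r multiplies squares at frequency m by at
  most (r|m|)^(-alpha), and alpha > alpha0 makes the resulting series converge. Frequency 0 is not
  damped at all, hence the maximum with 0. Cauchy-Schwarz costs a square root: single balls would
  yield only half the exponent. For m balls at once, with m at most e r^(-s), the bound is of order
  (e r^(2n-1-alpha-s))^(1/2), which is geometric over dyadic r and vanishes with e.\<close>

lemma nn_integral_lborel_shift: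
  fixes f :: "'a::euclidean_space \<Rightarrow> ennreal"
  assumes [measurable]: "f \<in> borel_measurable borel"
  shows "(\<integral>\<^sup>+x. f (c + x) \<partial>lborel) = (\<integral>\<^sup>+x. f x \<partial>lborel)"
proof -
  have "(\<integral>\<^sup>+x. f x \<partial>lborel) = (\<integral>\<^sup>+x. f x \<partial>distr lborel borel ((+) c))"
    by (simp add: lborel_distr_plus)
  also have "\<dots> = (\<integral>\<^sup>+x. f (c + x) \<partial>lborel)"
    by (subst nn_integral_distr) auto
  finally show ?thesis by simp
qed

text \<open>The image of Lebesgue measure under a linear isometry is translation invariant, so it is
  proportional to Lebesgue measure by the usual uniqueness argument for Haar measure (Fubini against
  the indicator of a ball); the unit ball, which is preserved, shows that the factor is 1.\<close>

lemma distr_lborel_linear_isometry: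
  fixes T :: "'a::euclidean_space \<Rightarrow> 'a"
  assumes T: "linear T" and norm_T: "\<And>x. norm (T x) = norm x"
  shows "distr lborel borel T = lborel"
proof (rule measure_eqI)
  fix A assume "A \<in> sets (distr lborel borel T)"
  then have A [measurable]: "A \<in> sets borel" by simp
  have T_meas [measurable]: "T \<in> borel_measurable borel"
    by (intro borel_measurable_continuous_onI linear_continuous_on)
      (simp add: T linear_conv_bounded_linear[symmetric])
  have [measurable]: "ball (0::'a) 1 \<in> sets borel" by simp
  have "inj T"
    by (metis T linear_injective_0 norm_T norm_eq_zero)
  then have surj: "surj T"
    using T linear_injective_imp_surjective by blast
  let ?f = "indicator A :: 'a \<Rightarrow> ennreal"
  let ?g = "indicator (ball 0 1) :: 'a \<Rightarrow> ennreal"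
  have g_iso: "?g (- T x) = ?g x" for x
    by (simp add: indicator_def norm_T)
  have "(\<integral>\<^sup>+x. ?f (T x) \<partial>lborel) * (\<integral>\<^sup>+y. ?g y \<partial>lborel)
      = (\<integral>\<^sup>+x. (\<integral>\<^sup>+y. ?f (T x) * ?g y \<partial>lborel) \<partial>lborel)"
    by (subst nn_integral_multc[symmetric], measurable)
      (intro nn_integral_cong nn_integral_cmult[symmetric], auto intro!: borel_measurable_indicator)
  \<comment> \<open>Shifting \<open>y\<close> by \<open>- T x\<close> and then \<open>x\<close> by a
    preimage of \<open>y\<close> under \<open>T\<close> frees the ball indicator of
    \<open>y\<close>, so that the inner integral over \<open>y\<close> becomes the measure of
    \<open>A\<close>.\<close>
  also have "\<dots> = (\<integral>\<^sup>+x. (\<integral>\<^sup>+y. ?f (T x) * ?g (- T x + y) \<partial>lborel) \<partial>lborel)"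
    by (rule nn_integral_cong, rule nn_integral_lborel_shift[symmetric]) measurable
  also have "\<dots> = (\<integral>\<^sup>+y. (\<integral>\<^sup>+x. ?f (T x) * ?g (- T x + y) \<partial>lborel) \<partial>lborel)"
    by (rule lborel_pair.Fubini') measurable
  also have "\<dots> = (\<integral>\<^sup>+y. (\<integral>\<^sup>+x. ?f (y + T x) * ?g (- T x) \<partial>lborel) \<partial>lborel)"
  proof (rule nn_integral_cong)
    fix y
    obtain w where w: "y = T w" using surj by blast
    have "(\<integral>\<^sup>+x. ?f (T x) * ?g (- T x + y) \<partial>lborel)
        = (\<integral>\<^sup>+x. ?f (T (w + x)) * ?g (- T (w + x) + y) \<partial>lborel)"
      by (rule nn_integral_lborel_shift[symmetric]) measurable
    then show "(\<integral>\<^sup>+x. ?f (T x) * ?g (- T x + y) \<partial>lborel)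
        = (\<integral>\<^sup>+x. ?f (y + T x) * ?g (- T x) \<partial>lborel)"
      by (simp add: w linear_add[OF T])
  qed
  also have "\<dots> = (\<integral>\<^sup>+x. (\<integral>\<^sup>+y. ?f (y + T x) * ?g (- T x) \<partial>lborel) \<partial>lborel)"
    by (rule lborel_pair.Fubini') measurable
  also have "\<dots> = (\<integral>\<^sup>+x. (\<integral>\<^sup>+y. ?f (T x + y) \<partial>lborel) * ?g x \<partial>lborel)"
    by (simp add: g_iso nn_integral_multc add.commute)
  also have "\<dots> = (\<integral>\<^sup>+x. (\<integral>\<^sup>+y. ?f y \<partial>lborel) * ?g x \<partial>lborel)"
    by (subst nn_integral_lborel_shift) auto
  also have "\<dots> = (\<integral>\<^sup>+y. ?f y \<partial>lborel) * (\<integral>\<^sup>+y. ?g y \<partial>lborel)"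
    by (simp add: nn_integral_cmult)
  finally have eq: "(\<integral>\<^sup>+x. ?f (T x) \<partial>lborel) * emeasure lborel (ball (0::'a) 1)
      = emeasure lborel A * emeasure lborel (ball (0::'a) 1)" by simp
  have "emeasure lborel (ball (0::'a) 1) \<noteq> 0" "emeasure lborel (ball (0::'a) 1) \<noteq> top"
    using emeasure_lborel_ball_finite[of "0::'a" 1]
    by (auto simp: emeasure_ball order_less_imp_not_eq2)
  then have "(\<integral>\<^sup>+x. ?f (T x) \<partial>lborel) = emeasure lborel A"
    using eq by (metis ennreal_mult_cancel_left mult.commute)
  moreover have "(\<integral>\<^sup>+x. ?f (T x) \<partial>lborel) = emeasure (distr lborel borel T) A"
    by (subst nn_integral_distr[symmetric, where M'=borel]) auto
  ultimately show "emeasure (distr lborel borel T) A = emeasure lborel A" by simp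
qed simp

definition rot :: "real \<Rightarrow> complex ^ 'n::finite \<Rightarrow> complex ^ 'n" where
  "rot t z = cis t *s z"

lemma rot_nth [simp]: "rot t z $ i = cis t * z $ i"
  by (simp add: rot_def)

lemma norm_vector_scalar_mult: "norm (c *s z) = cmod c * norm z" for z :: "complex ^ 'n::finite"
  by (simp add: norm_vec_def L2_set_def norm_mult power_mult_distrib real_sqrt_mult
      flip: sum_distrib_left)

lemma norm_rot [simp]: "norm (rot t z) = norm z"
  by (simp add: rot_def norm_vector_scalar_mult)

lemma linear_rot: "linear (rot t)"
  by (rule linearI) (simp_all add: vec_eq_iff algebra_simps)

text \<open>|e^(it) - 1| = 2 |sin(t/2)| \<le> |t|. On the unit sphere an arc with parameters in
  [-r, r] thus stays within Euclidean distance r of its midpoint, without an extra constant.\<close>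

lemma dist_rot_self_le: "dist (rot t z) z \<le> \<bar>t\<bar> * norm z"
proof -
  have diff: "rot t z - z = (cis t - 1) *s z"
    by (auto simp: vec_eq_iff algebra_simps)
  moreover have "cmod (cis t - 1) \<le> \<bar>t\<bar>"
    using dist_exp_i_1[of t] abs_sin_x_le_abs_x[of "t / 2"] by (simp add: cis_conv_exp)
  ultimately show ?thesis
    unfolding dist_norm diff norm_vector_scalar_mult by (simp add: mult_right_mono)
qed

lemma sgn_rot: "sgn (rot t z) = rot t (sgn z)"
  by (simp add: sgn_div_norm linear_cmul[OF linear_rot])

lemma continuous_on_rot [continuous_intros]:
  assumes "continuous_on A f" "continuous_on A g"
  shows "continuous_on A (\<lambda>x. rot (f x) (g x))"
  unfolding rot_def vector_scalar_mult_def cis_conv_exp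
  by (intro continuous_intros assms)

lemma rot_measurable [measurable]: "rot t \<in> borel_measurable borel"
  by (intro borel_measurable_continuous_onI continuous_intros)

lemma sets_sphere_measure_iff:
  "E \<in> sets sphere_measure \<longleftrightarrow> E \<in> sets borel \<and> E \<subseteq> usphere"
  by (auto simp: sets_sphere_measure sets_restrict_space_iff)

lemma borel_measurable_sphere_measureI:
  assumes "f \<in> borel_measurable borel"
  shows "f \<in> borel_measurable sphere_measure"
  using measurable_restrict_space1[OF assms] measurable_cong_sets[OF sets_sphere_measure refl]
  by auto

lemma rot_measurable_sphere [measurable]: "rot t \<in> sphere_measure \<rightarrow>\<^sub>M sphere_measure"
proof -
  have "rot t \<in> restrict_space borel usphere \<rightarrow>\<^sub>M restrict_space borel usphere"
    by (rule measurable_restrict_space3) auto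
  then show ?thesis
    using measurable_cong_sets[OF sets_sphere_measure sets_sphere_measure] by auto
qed

text \<open>Both ingredients of the cone measure respect \<open>rot t\<close>: Lebesgue measure on
  the unit ball is invariant, and \<open>sgn\<close> commutes with the rotation.\<close>

lemma distr_sphere_measure_rot: "distr sphere_measure sphere_measure (rot t) = sphere_measure"
proof (rule measure_eqI)
  fix E :: "(complex ^ 'n) set"
  assume "E \<in> sets (distr sphere_measure sphere_measure (rot t))"
  then have E: "E \<in> sets sphere_measure" by simp
  have E_b [measurable]: "E \<in> sets borel" and E_s: "E \<subseteq> usphere"
    using E by (auto simp: sets_sphere_measure_iff)
  have [measurable]: "(sgn :: complex ^ 'n \<Rightarrow> _) \<in> borel_measurable borel"
    by (simp add: sgn_div_norm[abs_def])
  have pre: "rot t -` E \<inter> usphere = rot t -` E"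
    using E_s norm_rot by auto
  have pre_b: "rot t -` E \<in> sets borel"
    using measurable_sets_borel[OF rot_measurable E_b] by simp
  have *: "{x \<in> ball 0 1. sgn x \<in> E} \<in> sets borel" by measurable
  have "emeasure (distr sphere_measure sphere_measure (rot t)) E
      = emeasure sphere_measure (rot t -` E)"
    using E pre by (simp add: emeasure_distr space_sphere_measure)
  also have "\<dots> = emeasure lborel {x \<in> ball 0 1. sgn x \<in> rot t -` E}
      / emeasure lborel (ball (0 :: complex ^ 'n) 1)"
    using pre pre_b by (intro emeasure_sphere_measure) auto
  also have "{x \<in> ball 0 1. sgn x \<in> rot t -` E} = rot t -` {x \<in> ball 0 1. sgn x \<in> E} \<inter> space lborel"
    by (auto simp: sgn_rot)
  also have "emeasure lborel \<dots> = emeasure (distr lborel borel (rot t)) {x \<in> ball 0 1. sgn x \<in> E}"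
    using * by (intro emeasure_distr[symmetric]) auto
  also have "distr lborel borel (rot t) = (lborel :: (complex ^ 'n) measure)"
    by (rule distr_lborel_linear_isometry[OF linear_rot norm_rot])
  also have "emeasure lborel {x \<in> ball 0 1. sgn x \<in> E} / emeasure lborel (ball (0 :: complex ^ 'n) 1)
      = emeasure sphere_measure E"
    using E_b E_s by (rule emeasure_sphere_measure[symmetric])
  finally show "emeasure (distr sphere_measure sphere_measure (rot t)) E = emeasure sphere_measure E" .
qed simp

lemma integral_sphere_measure_rot:
  fixes f :: "complex ^ 'n::finite \<Rightarrow> 'b::{banach, second_countable_topology}"
  assumes "f \<in> borel_measurable sphere_measure"
  shows "(LINT z|sphere_measure. f (rot t z)) = (LINT z|sphere_measure. f z)"
  using integral_distr[OF rot_measurable_sphere assms, of t] by (simp add: distr_sphere_measure_rot)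

text \<open>The exponent drops from 2n to 2n-1 because about 1/\<rho> balls of volume comparable to
  \<rho>^(2n) are used. The range up to 3 serves the radii \<open>3 * r\<close> with
  \<open>r \<le> 1\<close>.\<close>

lemma measure_sphere_measure_ball_le:
  fixes x :: "complex ^ 'n::finite"
  assumes x: "x \<in> usphere" and \<rho>: "0 < \<rho>" "\<rho> \<le> 3"
  shows "measure sphere_measure (ball x \<rho> \<inter> usphere)
    \<le> 4 * 2 ^ (2 * CARD('n)) * \<rho> ^ (2 * CARD('n) - 1)"
proof -
  let ?D = "DIM(complex ^ 'n)"
  let ?B = "ball (0 :: complex ^ 'n) 1"
  define V where "V = unit_ball_vol (real ?D)"
  have V: "V > 0" by (simp add: V_def)
  have D: "?D = 2 * CARD('n)" by simp
  \<comment> \<open>The cone over the cap is covered by about \<open>1 / \<rho>\<close> balls of radius \<open>2 * \<rho>\<close> along its axis.\<close>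
  define N where "N = nat \<lfloor>1 / \<rho>\<rfloor>"
  have N: "real N \<le> 1 / \<rho>" using \<rho> by (simp add: N_def)
  have sub: "{y \<in> ?B. sgn y \<in> ball x \<rho> \<inter> usphere}
      \<subseteq> (\<Union>i\<in>{..N}. ball ((real i * \<rho>) *\<^sub>R x) (2 * \<rho>))"
  proof
    fix y assume y: "y \<in> {y \<in> ?B. sgn y \<in> ball x \<rho> \<inter> usphere}"
    define t where "t = norm y"
    have t: "0 \<le> t" "t < 1" using y by (auto simp: t_def)
    define i where "i = nat \<lfloor>t / \<rho>\<rfloor>"
    have "t / \<rho> \<le> 1 / \<rho>" using t \<rho> by (simp add: divide_right_mono)
    then have "i \<le> N" unfolding i_def N_def by (intro nat_mono floor_mono)
    have "real i \<le> t / \<rho>" "t / \<rho> < real i + 1"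
      using t \<rho> by (auto simp: i_def) 
    then have i: "real i * \<rho> \<le> t" "t < real i * \<rho> + \<rho>"
      using \<rho> by (simp_all add: field_simps)
    have y_eq: "y = t *\<^sub>R sgn y" by (cases "y = 0") (simp_all add: t_def sgn_div_norm)
    have "(real i * \<rho>) *\<^sub>R x - y = (real i * \<rho> - t) *\<^sub>R x + t *\<^sub>R (x - sgn y)"
      by (subst y_eq) (simp add: algebra_simps)
    then have "dist ((real i * \<rho>) *\<^sub>R x) y \<le> \<bar>real i * \<rho> - t\<bar> * norm x + \<bar>t\<bar> * norm (x - sgn y)"
      by (metis dist_norm norm_scaleR norm_triangle_ineq)
    also have "\<dots> \<le> \<bar>real i * \<rho> - t\<bar> + norm (x - sgn y)"
      using x t by (simp add: mult_left_le_one_le)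
    also have "\<dots> < 2 * \<rho>" using i y by (auto simp: dist_norm)
    finally show "y \<in> (\<Union>i\<in>{..N}. ball ((real i * \<rho>) *\<^sub>R x) (2 * \<rho>))"
      using \<open>i \<le> N\<close> by auto
  qed
  have "emeasure lborel {y \<in> ?B. sgn y \<in> ball x \<rho> \<inter> usphere}
      \<le> emeasure lborel (\<Union>i\<in>{..N}. ball ((real i * \<rho>) *\<^sub>R x) (2 * \<rho>))"
    by (rule emeasure_mono[OF sub]) simp
  also have "\<dots> \<le> (\<Sum>i\<in>{..N}. emeasure lborel (ball ((real i * \<rho>) *\<^sub>R x) (2 * \<rho>)))"
    by (rule emeasure_subadditive_finite) auto
  also have "\<dots> = ennreal ((real N + 1) * (V * (2 * \<rho>) ^ ?D))"
    using \<rho> V by (simp add: emeasure_ball V_def[symmetric] ennreal_of_nat_eq_real_of_nat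
        distrib_right add.commute flip: ennreal_mult'' ennreal_plus del: DIM_cart)
  finally have 1: "emeasure lborel {y \<in> ?B. sgn y \<in> ball x \<rho> \<inter> usphere}
      \<le> ennreal ((real N + 1) * (V * (2 * \<rho>) ^ ?D))" .
  have "emeasure sphere_measure (ball x \<rho> \<inter> usphere)
      = emeasure lborel {y \<in> ?B. sgn y \<in> ball x \<rho> \<inter> usphere} / emeasure lborel ?B"
    by (rule emeasure_sphere_measure) auto
  also have "\<dots> \<le> ennreal ((real N + 1) * (V * (2 * \<rho>) ^ ?D)) / emeasure lborel ?B"
    by (rule divide_right_mono_ennreal[OF 1])
  also have "\<dots> = ennreal ((real N + 1) * (2 * \<rho>) ^ ?D)"
    using V \<rho> by (simp add: emeasure_ball V_def[symmetric] divide_ennreal del: DIM_cart)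
  finally have "measure sphere_measure (ball x \<rho> \<inter> usphere) \<le> (real N + 1) * (2 * \<rho>) ^ ?D"
    using \<rho> by (simp add: measure_def enn2real_leI)
  \<comment> \<open>From \<open>N \<le> 1 / \<rho>\<close> and \<open>\<rho> \<le> 3\<close>: N + 1
    \<le> (1 + \<rho>)/\<rho> \<le> 4/\<rho>.\<close>
  also have "\<dots> \<le> (4 / \<rho>) * (2 * \<rho>) ^ ?D"
    using N \<rho> by (intro mult_right_mono) (auto simp: field_simps)
  also have "\<dots> = 4 * 2 ^ (2 * CARD('n)) * \<rho> ^ (2 * CARD('n) - 1)"
  proof -
    have "\<rho> ^ (2 * CARD('n)) = \<rho> * \<rho> ^ (2 * CARD('n) - 1)"
      by (metis D DIM_positive power_eq_if neq0_conv)
    then show ?thesis using \<rho> by (simp add: D power_mult_distrib mult.commute)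
  qed
  finally show ?thesis .
qed

section \<open>Fourier coefficients of Riesz products\<close>

text \<open>\<open>riesz_coeff J b b' N m\<close> is the coefficient of \<open>w\<^sup>m\<close> in
  \<open>\<Prod>k=1..N. (1 + b k * w ^ J k + b' k * w ^ -J k)\<close>.\<close>

fun riesz_coeff :: "(nat \<Rightarrow> nat) \<Rightarrow> (nat \<Rightarrow> 'a) \<Rightarrow> (nat \<Rightarrow> 'a) \<Rightarrow> nat \<Rightarrow> int \<Rightarrow> 'a::comm_ring_1" where
  "riesz_coeff J b b' 0 m = (if m = 0 then 1 else 0)"
| "riesz_coeff J b b' (Suc N) m = riesz_coeff J b b' N m
     + b (Suc N) * riesz_coeff J b b' N (m - int (J (Suc N)))
     + b' (Suc N) * riesz_coeff J b b' N (m + int (J (Suc N)))"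

text \<open>An interval instead of the set of frequencies actually occurring: it is easy to shift,
  and the additional entries carry coefficient 0.\<close>

definition freqs :: "(nat \<Rightarrow> nat) \<Rightarrow> nat \<Rightarrow> int set" where
  "freqs J N = {- (\<Sum>k=1..N. int (J k))..(\<Sum>k=1..N. int (J k))}"

lemma finite_freqs [simp]: "finite (freqs J N)"
  by (simp add: freqs_def)

lemma riesz_coeff_eq_0: "m \<notin> freqs J N \<Longrightarrow> riesz_coeff J b b' N m = 0"
proof (induction N arbitrary: m)
  case (Suc N)
  then have "m \<notin> freqs J N" "m - int (J (Suc N)) \<notin> freqs J N" "m + int (J (Suc N)) \<notin> freqs J N"
    by (auto simp: freqs_def)
  then show ?case by (simp add: Suc.IH)
qed (simp add: freqs_def)

lemma sum_freqs_shift: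
  fixes g :: "int \<Rightarrow> 'a::comm_monoid_add"
  assumes "\<And>m. m \<notin> freqs J N \<Longrightarrow> g m = 0" and "\<bar>j\<bar> \<le> int (J (Suc N))"
  shows "(\<Sum>m\<in>freqs J (Suc N). g (m + j)) = (\<Sum>m\<in>freqs J N. g m)"
proof -
  have "(\<Sum>m\<in>freqs J (Suc N). g (m + j)) = (\<Sum>m\<in>(\<lambda>m. m + j) ` freqs J (Suc N). g m)"
    by (simp add: sum.reindex)
  also have "\<dots> = (\<Sum>m\<in>freqs J N. g m)"
  proof (rule sum.mono_neutral_right)
    show "freqs J N \<subseteq> (\<lambda>m. m + j) ` freqs J (Suc N)"
    proof
      fix m assume "m \<in> freqs J N"
      then have "m - j \<in> freqs J (Suc N)" using assms(2) by (auto simp: freqs_def)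
      then show "m \<in> (\<lambda>m. m + j) ` freqs J (Suc N)"
        by (rule rev_image_eqI) simp
    qed
  qed (use assms in auto)
  finally show ?thesis .
qed

text \<open>Setting w = 1 in the product. Nothing is lost, since \<open>b\<close> and
  \<open>b'\<close> may carry the values of functions at a point; this is how the partial products
  are split into components.\<close>

lemma sum_riesz_coeff:
  "(\<Sum>m\<in>freqs J N. riesz_coeff J b b' N m) = (\<Prod>k=1..N. 1 + b k + b' k)"
proof (induction N)
  case 0
  show ?case by (simp add: freqs_def)
next
  case (Suc N)
  let ?c = "riesz_coeff J b b' N" and ?j = "int (J (Suc N))"
  have shift: "(\<Sum>m\<in>freqs J (Suc N). ?c (m + j)) = (\<Sum>m\<in>freqs J N. ?c m)" if "\<bar>j\<bar> \<le> ?j" for j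
    by (rule sum_freqs_shift) (use that in \<open>auto intro: riesz_coeff_eq_0\<close>)
  show ?case
    using shift[of 0] shift[of ?j] shift[of "- ?j"] Suc.IH
    by (simp add: sum.distrib algebra_simps flip: sum_distrib_left)
qed

text \<open>The coefficients are polynomials in the \<open>b k\<close> and \<open>b' k\<close> with
  nonnegative coefficients, hence monotone under termwise domination.\<close>

lemma norm_riesz_coeff_le:
  fixes b b' :: "nat \<Rightarrow> 'a::{real_normed_algebra_1, comm_ring_1}"
  assumes "\<And>k. k \<ge> 1 \<Longrightarrow> norm (b k) \<le> \<beta> k" "\<And>k. k \<ge> 1 \<Longrightarrow> norm (b' k) \<le> \<beta> k"
  shows "norm (riesz_coeff J b b' N m) \<le> riesz_coeff J \<beta> \<beta> N m"
proof (induction N arbitrary: m)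
  case (Suc N)
  have le: "norm (x * y) \<le> u * v" if "norm x \<le> u" "norm y \<le> v" for x y :: 'a and u v
    by (rule order_trans[OF norm_mult_ineq])
      (use that in \<open>auto intro!: mult_mono intro: order_trans[OF norm_ge_zero]\<close>)
  show ?case
    unfolding riesz_coeff.simps
    by (intro order_trans[OF norm_triangle_ineq] add_mono le Suc.IH assms) auto
qed auto

lemma riesz_coeff_nonneg:
  fixes \<beta> :: "nat \<Rightarrow> real"
  assumes "\<And>k. \<beta> k \<ge> 0"
  shows "riesz_coeff J \<beta> \<beta> N m \<ge> 0"
  by (rule order_trans[OF norm_ge_zero norm_riesz_coeff_le[where b=\<beta> and b'=\<beta>]]) (auto simp: assms)

text \<open>Substituting e^(it) w for w multiplies the coefficient of w^m by e^(imt).\<close>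

lemma riesz_coeff_rotate:
  "riesz_coeff J (\<lambda>k. cis (real (J k) * t) * b k) (\<lambda>k. cis (- (real (J k) * t)) * b' k) N m
    = cis (of_int m * t) * riesz_coeff J b b' N m"
proof (induction N arbitrary: m)
  case (Suc N)
  have "(cis (real (J (Suc N)) * t) * x) * (cis (of_int (m - int (J (Suc N))) * t) * y) = cis (of_int m * t) * (x * y)"
    "(cis (- (real (J (Suc N)) * t)) * x) * (cis (of_int (m + int (J (Suc N))) * t) * y) = cis (of_int m * t) * (x * y)"
    for x y
  proof -
    have "cis (real (J (Suc N)) * t) * cis (of_int (m - int (J (Suc N))) * t) = cis (of_int m * t)"
      "cis (- (real (J (Suc N)) * t)) * cis (of_int (m + int (J (Suc N))) * t) = cis (of_int m * t)"
      by (simp_all add: cis_mult algebra_simps)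
    moreover have "(u * x) * (v * y) = (u * v) * (x * y)" for u v :: complex
      by (simp add: mult_ac)
    ultimately show "(cis (real (J (Suc N)) * t) * x) * (cis (of_int (m - int (J (Suc N))) * t) * y) = cis (of_int m * t) * (x * y)"
      "(cis (- (real (J (Suc N)) * t)) * x) * (cis (of_int (m + int (J (Suc N))) * t) * y) = cis (of_int m * t) * (x * y)"
      by presburger+
  qed
  then show ?case
    by (simp only: riesz_coeff.simps Suc.IH distrib_left)
qed simp

text \<open>This is where ratio 3 matters: 1/3 + 1/9 + ... = 1/2. The interval
  \<open>freqs J N\<close> is shorter than \<open>J (Suc N)\<close>, so it is disjoint from its
  translates by plus and minus \<open>J (Suc N)\<close>.\<close>

lemma lacunary_sum_less:
  fixes J :: "nat \<Rightarrow> nat"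
  assumes "\<And>k. k \<ge> 1 \<Longrightarrow> J k > 0" "\<And>k. k \<ge> 1 \<Longrightarrow> 3 * J k \<le> J (Suc k)"
  shows "2 * (\<Sum>k=1..N. int (J k)) < int (J (Suc N))"
proof (induction N)
  case 0
  show ?case using assms(1)[of 1] by simp
next
  case (Suc N)
  show ?case using Suc assms(2)[of "Suc N"] by simp
qed

context
  fixes J :: "nat \<Rightarrow> nat" and \<beta> :: "nat \<Rightarrow> real"
  assumes J_pos: "\<And>k. k \<ge> 1 \<Longrightarrow> J k > 0" and J_lac: "\<And>k. k \<ge> 1 \<Longrightarrow> 3 * J k \<le> J (Suc k)"
    and \<beta>_nonneg: "\<And>k. \<beta> k \<ge> 0"
begin

text \<open>Lacunarity makes the three summands in the recursion for the coefficients have disjoint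
  supports, so squaring produces no cross terms.\<close>

lemma sum_riesz_coeff_sq_Suc:
  fixes \<psi> :: "int \<Rightarrow> real"
  shows "(\<Sum>m\<in>freqs J (Suc N). (riesz_coeff J \<beta> \<beta> (Suc N) m)\<^sup>2 * \<psi> m)
    = (\<Sum>m\<in>freqs J N. (riesz_coeff J \<beta> \<beta> N m)\<^sup>2 *
        (\<psi> m + (\<beta> (Suc N))\<^sup>2 * (\<psi> (m + int (J (Suc N))) + \<psi> (m - int (J (Suc N))))))"
proof -
  let ?c = "riesz_coeff J \<beta> \<beta> N" and ?j = "int (J (Suc N))" and ?b = "\<beta> (Suc N)"
  have sq: "(riesz_coeff J \<beta> \<beta> (Suc N) m)\<^sup>2
      = (?c m)\<^sup>2 + ?b\<^sup>2 * (?c (m - ?j))\<^sup>2 + ?b\<^sup>2 * (?c (m + ?j))\<^sup>2" for m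
  proof -
    have gap: "2 * (\<Sum>k=1..N. int (J k)) < ?j"
      using lacunary_sum_less[of J N] J_pos J_lac by simp
    have zero: "?c m = 0 \<or> ?c m' = 0" if "\<bar>m - m'\<bar> \<ge> ?j" for m m'
    proof -
      have "m \<notin> freqs J N \<or> m' \<notin> freqs J N" using gap that by (auto simp: freqs_def)
      then show ?thesis using riesz_coeff_eq_0 by blast
    qed
    have "?c m = 0 \<or> ?c (m - ?j) = 0" "?c m = 0 \<or> ?c (m + ?j) = 0" "?c (m - ?j) = 0 \<or> ?c (m + ?j) = 0"
      by (rule zero, simp)+
    then show ?thesis by (auto simp: power2_eq_square)
  qed
  have shift: "(\<Sum>m\<in>freqs J (Suc N). (?c (m + j))\<^sup>2 * \<psi> (m + j + d)) = (\<Sum>m\<in>freqs J N. (?c m)\<^sup>2 * \<psi> (m + d))"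
    if "\<bar>j\<bar> \<le> ?j" for j d
    by (rule sum_freqs_shift[where g="\<lambda>m. (?c m)\<^sup>2 * \<psi> (m + d)"])
      (use that in \<open>auto simp: riesz_coeff_eq_0\<close>)
  have "(\<Sum>m\<in>freqs J (Suc N). (riesz_coeff J \<beta> \<beta> (Suc N) m)\<^sup>2 * \<psi> m)
    = (\<Sum>m\<in>freqs J (Suc N). (?c m)\<^sup>2 * \<psi> m) + ?b\<^sup>2 * (\<Sum>m\<in>freqs J (Suc N). (?c (m - ?j))\<^sup>2 * \<psi> m)
      + ?b\<^sup>2 * (\<Sum>m\<in>freqs J (Suc N). (?c (m + ?j))\<^sup>2 * \<psi> m)"
    unfolding sq by (simp add: sum_distrib_left distrib_right sum.distrib mult.assoc)
  also have "\<dots> = (\<Sum>m\<in>freqs J N. (?c m)\<^sup>2 * \<psi> m) + ?b\<^sup>2 * (\<Sum>m\<in>freqs J N. (?c m)\<^sup>2 * \<psi> (m + ?j))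
      + ?b\<^sup>2 * (\<Sum>m\<in>freqs J N. (?c m)\<^sup>2 * \<psi> (m - ?j))"
    using shift[of 0 0] shift[of "- ?j" ?j] shift[of ?j "- ?j"] by simp
  finally show ?thesis
    by (simp add: sum_distrib_left distrib_left sum.distrib mult_ac)
qed

lemma sum_riesz_coeff_sq:
  "(\<Sum>m\<in>freqs J N. (riesz_coeff J \<beta> \<beta> N m)\<^sup>2) = (\<Prod>k=1..N. 1 + 2 * (\<beta> k)\<^sup>2)"
proof (induction N)
  case 0
  show ?case by (simp add: freqs_def)
next
  case (Suc N)
  have "(\<Sum>m\<in>freqs J (Suc N). (riesz_coeff J \<beta> \<beta> (Suc N) m)\<^sup>2)
      = (\<Sum>m\<in>freqs J N. (riesz_coeff J \<beta> \<beta> N m)\<^sup>2 * (1 + 2 * (\<beta> (Suc N))\<^sup>2))"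
    using sum_riesz_coeff_sq_Suc[where \<psi>="\<lambda>_. 1" and N=N]
    by (simp add: mult.commute del: riesz_coeff.simps)
  also have "\<dots> = (\<Prod>k=1..Suc N. 1 + 2 * (\<beta> k)\<^sup>2)"
    unfolding sum_distrib_right[symmetric] Suc.IH by simp
  finally show ?case .
qed

text \<open>The frequencies added at step k are those of step k-1, of modulus below J k / 2, moved
  by plus or minus J k. Their modulus exceeds J k / 2, so each has weight at most D (J k /
  2)^(-\<alpha>), which is the source of 2^\<alpha>; their squared mass is 2 (\<beta> k)^2 times the
  full mass of the preceding step. The leading 1 is the initial frequency 0.\<close>

lemma sum_riesz_coeff_sq_weighted_le:
  fixes \<psi> :: "int \<Rightarrow> real"
  assumes \<psi>0: "\<psi> 0 \<le> 1" and \<psi>: "\<And>m. m \<noteq> 0 \<Longrightarrow> \<psi> m \<le> D * real_of_int \<bar>m\<bar> powr - \<alpha>"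
    and D: "D \<ge> 0" and \<alpha>: "\<alpha> > 0"
  shows "(\<Sum>m\<in>freqs J N. (riesz_coeff J \<beta> \<beta> N m)\<^sup>2 * \<psi> m)
    \<le> 1 + D * 2 powr \<alpha> *
        (\<Sum>k=1..N. 2 * (\<beta> k)\<^sup>2 * (\<Prod>l=1..<k. 1 + 2 * (\<beta> l)\<^sup>2) * real (J k) powr - \<alpha>)"
proof (induction N)
  case 0
  show ?case using \<psi>0 by (simp add: freqs_def)
next
  case (Suc N)
  let ?c = "riesz_coeff J \<beta> \<beta> N" and ?j = "int (J (Suc N))" and ?b = "\<beta> (Suc N)"
  let ?K = "D * 2 powr \<alpha> * real (J (Suc N)) powr - \<alpha>"
  have \<psi>_le: "\<psi> i \<le> ?K" if "2 * \<bar>i\<bar> \<ge> ?j" for i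
  proof -
    have J: "J (Suc N) > 0" using J_pos by simp
    then have "i \<noteq> 0" using that by auto
    then have "\<psi> i \<le> D * real_of_int \<bar>i\<bar> powr - \<alpha>" by (rule \<psi>)
    also have "real_of_int \<bar>i\<bar> powr - \<alpha> \<le> (real (J (Suc N)) / 2) powr - \<alpha>"
      using J \<alpha> that by (intro powr_mono2') auto
    then have "D * real_of_int \<bar>i\<bar> powr - \<alpha> \<le> D * (real (J (Suc N)) / 2) powr - \<alpha>"
      using D by (rule mult_left_mono)
    also have "\<dots> = ?K"
      by (simp add: powr_divide powr_minus field_simps)
    finally show ?thesis .
  qed
  have gap: "2 * (\<Sum>k=1..N. int (J k)) < ?j"
    using lacunary_sum_less[of J N] J_pos J_lac by simp
  have "(\<Sum>m\<in>freqs J (Suc N). (riesz_coeff J \<beta> \<beta> (Suc N) m)\<^sup>2 * \<psi> m)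
    \<le> (\<Sum>m\<in>freqs J N. (?c m)\<^sup>2 * (\<psi> m + ?b\<^sup>2 * (?K + ?K)))"
    unfolding sum_riesz_coeff_sq_Suc
  proof (intro sum_mono mult_left_mono add_mono order_refl)
    fix m assume "m \<in> freqs J N"
    then have "2 * \<bar>m + ?j\<bar> \<ge> ?j" "2 * \<bar>m - ?j\<bar> \<ge> ?j" using gap by (auto simp: freqs_def)
    then show "\<psi> (m + ?j) \<le> ?K" "\<psi> (m - ?j) \<le> ?K" by (auto intro: \<psi>_le)
  qed auto
  also have "\<dots> = (\<Sum>m\<in>freqs J N. (?c m)\<^sup>2 * \<psi> m) + (\<Sum>m\<in>freqs J N. (?c m)\<^sup>2) * (2 * ?b\<^sup>2 * ?K)"
    by (simp add: sum_distrib_left sum_distrib_right distrib_left sum.distrib mult_ac)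
  also have "\<dots> \<le> 1 + D * 2 powr \<alpha> *
        (\<Sum>k=1..N. 2 * (\<beta> k)\<^sup>2 * (\<Prod>l=1..<k. 1 + 2 * (\<beta> l)\<^sup>2) * real (J k) powr - \<alpha>)
      + (\<Prod>k=1..N. 1 + 2 * (\<beta> k)\<^sup>2) * (2 * ?b\<^sup>2 * ?K)"
    using Suc.IH by (simp add: sum_riesz_coeff_sq)
  also have "\<dots> = 1 + D * 2 powr \<alpha> *
        (\<Sum>k=1..Suc N. 2 * (\<beta> k)\<^sup>2 * (\<Prod>l=1..<k. 1 + 2 * (\<beta> l)\<^sup>2) * real (J k) powr - \<alpha>)"
    by (simp add: atLeastLessThanSuc_atLeastAtMost algebra_simps)
  finally show ?case .
qed

end

section \<open>The exponent \<open>alpha0\<close> and summability\<close>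

text \<open>The squared mass of the coefficients that factor k adds when \<beta> k = |a k| / 2,
  since then 2 (\<beta> k)^2 = |a k|^2 / 2.\<close>

definition riesz_block :: "(nat \<Rightarrow> complex) \<Rightarrow> nat \<Rightarrow> real" where
  "riesz_block a k = (cmod (a k))\<^sup>2 / 2 * (\<Prod>l=1..<k. 1 + (cmod (a l))\<^sup>2 / 2)"

lemma riesz_block_nonneg: "riesz_block a k \<ge> 0"
  unfolding riesz_block_def by (intro mult_nonneg_nonneg prod_nonneg) auto

lemma elog_riesz_block:
  "elog ((cmod (a k))\<^sup>2 / 2) + (\<Sum>l=1..<k. elog (1 + (cmod (a l))\<^sup>2 / 2)) = elog (riesz_block a k)"
proof -
  have pos: "1 + (cmod z)\<^sup>2 / 2 > 0" for z
    by (rule add_pos_nonneg) auto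
  then have "elog (1 + (cmod (a l))\<^sup>2 / 2) = ereal (ln (1 + (cmod (a l))\<^sup>2 / 2))" for l
    by (auto simp: elog_def less_le)
  then have "(\<Sum>l=1..<k. elog (1 + (cmod (a l))\<^sup>2 / 2)) = ereal (\<Sum>l=1..<k. ln (1 + (cmod (a l))\<^sup>2 / 2))"
    by simp
  also have "(\<Sum>l=1..<k. ln (1 + (cmod (a l))\<^sup>2 / 2)) = ln (\<Prod>l=1..<k. 1 + (cmod (a l))\<^sup>2 / 2)"
    using pos by (intro ln_prod[symmetric]) (auto simp: less_imp_neq[symmetric])
  finally have sum: "(\<Sum>l=1..<k. elog (1 + (cmod (a l))\<^sup>2 / 2))
      = ereal (ln (\<Prod>l=1..<k. 1 + (cmod (a l))\<^sup>2 / 2))" .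
  have "(\<Prod>l=1..<k. 1 + (cmod (a l))\<^sup>2 / 2) > 0" using pos by (intro prod_pos) auto
  \<comment> \<open>The case \<open>x = 0\<close> holds because -\<infinity> absorbs the finite
    second summand.\<close>
  moreover have "elog x + ereal (ln P) = elog (x * P)" if "P > 0" "x \<ge> 0" for x P
    using that by (cases "x = 0") (auto simp: elog_def ln_mult)
  ultimately show ?thesis
    unfolding sum riesz_block_def by simp
qed

lemma lacunary_ge_power:
  fixes J :: "nat \<Rightarrow> nat"
  assumes "\<And>k. k \<ge> 1 \<Longrightarrow> J k > 0" "\<And>k. k \<ge> 1 \<Longrightarrow> 3 * J k \<le> J (Suc k)"
  shows "3 ^ k \<le> J (Suc k)"
proof (induction k)
  case 0
  show ?case using assms(1)[of 1] by (simp add: Suc_le_eq)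
next
  case (Suc k)
  show ?case using Suc assms(2)[of "Suc k"] by simp
qed

text \<open>For \<gamma> strictly between \<open>alpha0 J a\<close> and \<alpha>, the limsup gives
  \<open>riesz_block a k\<close> \<le> (J k)^\<gamma> eventually. The terms are then at most (J
  k)^(\<gamma> - \<alpha>), which decays geometrically because J k \<ge> 3^(k-1).\<close>

lemma summable_riesz_block:
  fixes J :: "nat \<Rightarrow> nat"
  assumes J_pos: "\<And>k. k \<ge> 1 \<Longrightarrow> J k > 0" and J_lac: "\<And>k. k \<ge> 1 \<Longrightarrow> 3 * J k \<le> J (Suc k)"
    and \<alpha>: "alpha0 J a < ereal \<alpha>"
  shows "summable (\<lambda>k. riesz_block a k * real (J k) powr - \<alpha>)"
proof -
  obtain \<gamma>' where \<gamma>': "alpha0 J a < \<gamma>'" "\<gamma>' < ereal \<alpha>" using \<alpha> dense by blast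
  then have "\<gamma>' \<noteq> \<infinity>" "\<gamma>' \<noteq> - \<infinity>" by auto
  then obtain \<gamma> where \<gamma>: "alpha0 J a < ereal \<gamma>" "\<gamma> < \<alpha>" using \<gamma>' by (cases \<gamma>') auto
  have "limsup (\<lambda>k. elog (riesz_block a k) / ereal (ln (real (J k)))) < ereal \<gamma>"
    using \<gamma>(1) unfolding alpha0_def elog_riesz_block by simp
  then have ev: "\<forall>\<^sub>F k in sequentially. elog (riesz_block a k) / ereal (ln (real (J k))) < ereal \<gamma>"
    by (rule Limsup_lessD)
  have bound: "\<forall>\<^sub>F k in sequentially.
      norm (riesz_block a k * real (J k) powr - \<alpha>) \<le> 3 powr (\<alpha> - \<gamma>) * (3 powr (\<gamma> - \<alpha>)) ^ k"
    using ev eventually_ge_at_top[of 2]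
  proof eventually_elim
    case (elim k)
    \<comment> \<open>From index 2 on \<open>J k\<close> is at least 3, so \<open>ln (J k)\<close>
      is positive and can be cleared from the quotient.\<close>
    have J3: "3 ^ (k - 1) \<le> J k"
      using lacunary_ge_power[of J "k - 1"] J_pos J_lac elim(2) by simp
    have "(3::nat) ^ 1 \<le> 3 ^ (k - 1)" using elim(2) by (intro power_increasing) auto
    then have "3 \<le> J k" using J3 by simp
    then have Jk: "real (J k) \<ge> 3" by linarith
    have B: "riesz_block a k \<le> real (J k) powr \<gamma>"
    proof (cases "riesz_block a k = 0")
      case False
      then have pos: "riesz_block a k > 0" using riesz_block_nonneg[of a k] by simp
      have "ln (riesz_block a k) / ln (real (J k)) < \<gamma>"
        using elim(1) False Jk by (simp add: elog_def)
      then have "ln (riesz_block a k) < \<gamma> * ln (real (J k))"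
        using Jk by (simp add: divide_less_eq)
      then have "exp (ln (riesz_block a k)) \<le> exp (\<gamma> * ln (real (J k)))" by simp
      then show ?thesis using pos Jk by (simp add: powr_def)
    qed simp
    have "norm (riesz_block a k * real (J k) powr - \<alpha>) = riesz_block a k * real (J k) powr - \<alpha>"
      using riesz_block_nonneg[of a k] by simp
    also have "\<dots> \<le> real (J k) powr \<gamma> * real (J k) powr - \<alpha>"
      using B by (intro mult_right_mono) auto
    also have "\<dots> = real (J k) powr - (\<alpha> - \<gamma>)" by (simp flip: powr_add)
    also have "\<dots> \<le> (3 ^ (k - 1)) powr - (\<alpha> - \<gamma>)"
      using \<gamma>(2) J3 by (intro powr_mono2') (auto simp flip: of_nat_le_iff)
    also have "\<dots> = 3 powr (\<alpha> - \<gamma>) * (3 powr (\<gamma> - \<alpha>)) ^ k"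
      using elim(2)
      by (simp add: powr_realpow[symmetric] powr_powr powr_power of_nat_diff algebra_simps
          flip: powr_add)
    finally show ?case .
  qed
  have "(3::real) powr (\<gamma> - \<alpha>) < 1" using \<gamma>(2) by (simp add: powr_less_one)
  then have "summable (\<lambda>k. 3 powr (\<alpha> - \<gamma>) * (3 powr (\<gamma> - \<alpha>)) ^ k :: real)"
    by (intro summable_mult summable_geometric) auto
  then show ?thesis using bound by (rule summable_comparison_test_ev[rotated])
qed

text \<open>Blocks grow at most like (3/2)^k while J grows at least like 3^k, so exponent 1 is
  always admissible. This allows exponents to be capped at 1, within the range where the multiplier
  estimate holds.\<close>

lemma summable_riesz_block_one:
  fixes J :: "nat \<Rightarrow> nat"
  assumes J_pos: "\<And>k. k \<ge> 1 \<Longrightarrow> J k > 0" and J_lac: "\<And>k. k \<ge> 1 \<Longrightarrow> 3 * J k \<le> J (Suc k)"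
    and a: "\<And>k. k \<ge> 1 \<Longrightarrow> cmod (a k) < 1"
  shows "summable (\<lambda>k. riesz_block a k * real (J k) powr - 1)"
proof (rule summable_comparison_test_ev)
  have B: "riesz_block a (Suc k) \<le> (3/2) ^ k" for k
  proof -
    have sq: "(cmod (a l))\<^sup>2 \<le> 1" if "l \<ge> 1" for l
      using a[OF that] by (simp add: power_le_one)
    have sq2: "(cmod (a (Suc k)))\<^sup>2 \<le> 2"
      using sq[of "Suc k"] by simp
    have "riesz_block a (Suc k) \<le> 1 * (\<Prod>l=1..<Suc k. 3/2)"
      unfolding riesz_block_def
      by (intro mult_mono prod_mono conjI prod_nonneg) (use sq sq2 in \<open>auto simp: add_nonneg_nonneg\<close>)
    then show ?thesis by simp
  qed
  show "\<forall>\<^sub>F k in sequentially. norm (riesz_block a k * real (J k) powr - 1) \<le> 2 * (1/2) ^ k"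
    using eventually_ge_at_top[of 1]
  proof eventually_elim
    case (elim k)
    then obtain i where k: "k = Suc i" by (cases k) auto
    have "real (3 ^ i) \<le> real (J k)"
      using lacunary_ge_power[of J i] J_pos J_lac unfolding k of_nat_le_iff by simp
    then have J: "3 ^ i \<le> real (J k)" by simp
    have J0: "real (J k) > 0" using J_pos elim by simp
    have "norm (riesz_block a k * real (J k) powr - 1) = riesz_block a k * (1 / real (J k))"
      using riesz_block_nonneg[of a k] J0 by (simp add: powr_minus_divide)
    also have "\<dots> \<le> (3/2) ^ i * (1 / 3 ^ i)"
      using B[of i] J J0 k by (intro mult_mono) (auto intro: divide_left_mono)
    also have "\<dots> = 2 * (1/2) ^ k"
      by (simp add: k power_divide)
    finally show ?case .
  qed
  show "summable (\<lambda>k. 2 * (1/2) ^ k :: real)"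
    by (intro summable_mult summable_geometric) auto
qed

lemma riesz_coeff_cong:
  assumes "\<And>k. k \<ge> 1 \<Longrightarrow> b k = d k" "\<And>k. k \<ge> 1 \<Longrightarrow> b' k = d' k"
  shows "riesz_coeff J b b' N m = riesz_coeff J d d' N m"
  by (induction N arbitrary: m) (simp_all add: assms)

section \<open>Averaging over arcs of slices\<close>

abbreviation arc_measure :: "real \<Rightarrow> real measure" where
  "arc_measure r \<equiv> uniform_measure lborel {-r..r}"

lemma prob_space_arc_measure: "r > 0 \<Longrightarrow> prob_space (arc_measure r)"
  by (intro prob_space_uniform_measure) auto

lemma integral_arc_measure:
  fixes f :: "real \<Rightarrow> 'b::{banach, second_countable_topology}"
  assumes r: "r > 0" and f: "f \<in> borel_measurable borel"
  shows "(LINT t|arc_measure r. f t) = (1 / (2 * r)) *\<^sub>R (LINT t|lborel. indicator {-r..r} t *\<^sub>R f t)"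
proof -
  have dens: "indicator {-r..r} t / emeasure lborel {-r..r} = ennreal (indicator {-r..r} t / (2 * r))" for t
    using r by (auto simp: indicator_def divide_ennreal ennreal_1[symmetric] simp del: ennreal_1)
  have "(LINT t|arc_measure r. f t) = (LINT t|lborel. (indicator {-r..r} t / (2 * r)) *\<^sub>R f t)"
    unfolding uniform_measure_def dens by (rule integral_density) (use r f in auto)
  also have "\<dots> = (LINT t|lborel. (1 / (2 * r)) *\<^sub>R (indicator {-r..r} t *\<^sub>R f t))"
    by simp
  finally show ?thesis by (simp only: integral_scaleR_right)
qed

text \<open>The Fourier multiplier of the arc average: sin(mr)/(mr) for nonzero m and positive r.
  Only the bounds 1 and 1/(r|m|) enter below.\<close>

definition arc_mult :: "real \<Rightarrow> int \<Rightarrow> complex" where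
  "arc_mult r m = (LINT t|arc_measure r. cis (of_int m * t))"

lemma cis_borel [measurable]: "(\<lambda>t. cis (c * t)) \<in> borel_measurable borel"
  unfolding cis_conv_exp by (intro borel_measurable_continuous_onI continuous_intros)

lemma cmod_arc_mult_le_1:
  assumes "r > 0"
  shows "cmod (arc_mult r m) \<le> 1"
proof -
  interpret prob_space "arc_measure r" by (rule prob_space_arc_measure[OF assms])
  have "cmod (arc_mult r m) \<le> (LINT t|arc_measure r. cmod (cis (of_int m * t)))"
    unfolding arc_mult_def by (rule integral_norm_bound)
  then show ?thesis using prob_space by simp
qed

lemma cmod_arc_mult_le:
  assumes r: "r > 0" and m: "m \<noteq> 0"
  shows "cmod (arc_mult r m) \<le> 1 / (r * real_of_int \<bar>m\<bar>)"
proof -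
  define c where "c = \<i> * complex_of_int m"
  have c: "c \<noteq> 0" "cmod c = real_of_int \<bar>m\<bar>" using m by (auto simp: c_def norm_mult)
  have cis: "cis (of_int m * t) = exp (c * of_real t)" for t
    by (simp add: cis_conv_exp c_def mult.assoc)
  let ?F = "\<lambda>t::real. exp (c * of_real t) / c"
  have "(LINT t|lborel. indicator {-r..r} t *\<^sub>R exp (c * of_real t)) = ?F r - ?F (- r)"
  proof (rule integral_FTC_Icc)
    fix t assume "- r \<le> t" "t \<le> r"
    show "(?F has_vector_derivative exp (c * of_real t)) (at t within {- r..r})"
      by (rule has_vector_derivative_real_field[where f="\<lambda>z. exp (c * z) / c"])
        (use c in \<open>auto intro!: derivative_eq_intros\<close>)
  qed (use r in \<open>auto intro!: continuous_intros\<close>)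
  then have "arc_mult r m = (1 / (2 * r)) *\<^sub>R (?F r - ?F (- r))"
    unfolding arc_mult_def by (subst integral_arc_measure[OF r]) (auto simp: cis)
  moreover have "cmod (?F r - ?F (- r)) \<le> 2 / cmod c"
  proof -
    have "cmod (exp (c * of_real t)) = 1" for t
      by (simp flip: cis)
    then have "cmod (?F r) = 1 / cmod c" "cmod (?F (- r)) = 1 / cmod c"
      by (simp_all only: norm_divide)
    then show ?thesis using norm_triangle_ineq4[of "?F r" "?F (- r)"] by simp
  qed
  moreover have "norm ((1 / (2 * r)) *\<^sub>R x) \<le> 1 / (2 * r) * (2 / cmod c)" if "cmod x \<le> 2 / cmod c" for x
  proof -
    have "norm ((1 / (2 * r)) *\<^sub>R x) = 1 / (2 * r) * cmod x" using r by simp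
    also have "\<dots> \<le> 1 / (2 * r) * (2 / cmod c)" using r that by (intro mult_left_mono) auto
    finally show ?thesis .
  qed
  ultimately have "cmod (arc_mult r m) \<le> 1 / (2 * r) * (2 / cmod c)" by metis
  then show ?thesis using r c by simp
qed

text \<open>Interpolation between the two bounds: for x \<le> 1 and x \<le> y one has x^2 \<le>
  x^\<alpha> \<le> y^\<alpha>, the first inequality by \<alpha> \<le> 2.\<close>

lemma cmod_arc_mult_sq_le:
  assumes r: "r > 0" and m: "m \<noteq> 0" and \<alpha>: "0 < \<alpha>" "\<alpha> \<le> 2"
  shows "(cmod (arc_mult r m))\<^sup>2 \<le> r powr - \<alpha> * real_of_int \<bar>m\<bar> powr - \<alpha>"
proof -
  let ?y = "1 / (r * real_of_int \<bar>m\<bar>)"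
  have y: "?y > 0" using r m by simp
  have "(cmod (arc_mult r m))\<^sup>2 \<le> ?y powr \<alpha>"
  proof (cases "arc_mult r m = 0")
    case False
    then have pos: "cmod (arc_mult r m) > 0" by simp
    have "(cmod (arc_mult r m))\<^sup>2 = cmod (arc_mult r m) powr 2"
      using pos by simp
    also have "\<dots> \<le> cmod (arc_mult r m) powr \<alpha>"
      using \<alpha> pos cmod_arc_mult_le_1[OF r, of m] by (intro powr_mono') auto
    also have "\<dots> \<le> ?y powr \<alpha>"
      using \<alpha> cmod_arc_mult_le[OF r m] by (intro powr_mono2) auto
    finally show ?thesis .
  qed simp
  also have "?y powr \<alpha> = r powr - \<alpha> * real_of_int \<bar>m\<bar> powr - \<alpha>"
    using r by (simp add: powr_divide powr_minus powr_mult field_simps)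
  finally show ?thesis .
qed

definition arc_avg :: "real \<Rightarrow> (complex ^ 'n::finite \<Rightarrow> real) \<Rightarrow> complex ^ 'n \<Rightarrow> real" where
  "arc_avg r f z = (LINT t|arc_measure r. f (rot t z))"

context
  fixes f :: "complex ^ 'n::finite \<Rightarrow> real" and r :: real
  assumes f_cont: "continuous_on UNIV f" and f_ge0: "\<And>z. 0 \<le> f z" and f_le1: "\<And>z. f z \<le> 1"
    and r: "r > 0"
begin

interpretation arc: prob_space "arc_measure r"
  by (rule prob_space_arc_measure[OF r])

lemma arc_integrable: "integrable (arc_measure r) (\<lambda>t. f (rot t z))"
proof (rule arc.integrable_const_bound[where B=1])
  have "continuous_on UNIV (\<lambda>t. f (rot t z))"
    by (intro continuous_on_compose2[OF f_cont] continuous_intros) auto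
  then show "(\<lambda>t. f (rot t z)) \<in> borel_measurable (arc_measure r)"
    by (subst measurable_cong_sets[of _ lborel]) (auto intro: borel_measurable_continuous_onI)
qed (use f_ge0 f_le1 in auto)

lemma arc_avg_ge0: "0 \<le> arc_avg r f z"
  unfolding arc_avg_def by (intro integral_nonneg_AE) (simp add: f_ge0)

lemma arc_avg_le1: "arc_avg r f z \<le> 1"
proof -
  have "arc_avg r f z \<le> (LINT t|arc_measure r. 1)"
    unfolding arc_avg_def by (intro integral_mono arc_integrable) (auto simp: f_le1)
  then show ?thesis using arc.prob_space by simp
qed

lemma arc_avg_eq_1:
  assumes "z \<in> usphere" and one: "\<And>w. dist w z \<le> r \<Longrightarrow> f w = 1"
  shows "arc_avg r f z = 1"
proof -
  have "AE t in arc_measure r. f (rot t z) = 1"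
  proof -
    have "AE t in lborel. t \<in> {-r..r} \<longrightarrow> f (rot t z) = 1"
    proof (intro AE_I2 impI one)
      fix t assume "t \<in> {-r..r}"
      then show "dist (rot t z) z \<le> r"
        using dist_rot_self_le[of t z] \<open>z \<in> usphere\<close> by auto
    qed
    then show ?thesis by (intro AE_uniform_measureI) auto
  qed
  then have "arc_avg r f z = (LINT t|arc_measure r. 1)"
    unfolding arc_avg_def using arc_integrable
    by (intro integral_cong_AE) auto
  then show ?thesis using arc.prob_space by simp
qed

text \<open>Dominated convergence. Continuity makes the average an admissible test function for the
  weak-star limit.\<close>

lemma continuous_arc_avg: "continuous_on UNIV (arc_avg r f)"
proof -
  have "continuous (at z) (arc_avg r f)" for z
    unfolding continuous_at_sequentially
  proof (intro allI impI)
    fix x assume x: "x \<longlonglongrightarrow> z"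
    have "(\<lambda>n. LINT t|arc_measure r. f (rot t (x n))) \<longlonglongrightarrow> (LINT t|arc_measure r. f (rot t z))"
    proof (rule integral_dominated_convergence[where w="\<lambda>_. 1"])
      have "(\<lambda>n. f (rot t (x n))) \<longlonglongrightarrow> f (rot t z)" for t
      proof -
        have "continuous_on UNIV (\<lambda>z. f (rot t z))"
          by (intro continuous_on_compose2[OF f_cont] continuous_intros) auto
        then have "isCont (\<lambda>z. f (rot t z)) z"
          by (simp add: continuous_on_eq_continuous_at)
        then show ?thesis by (rule isCont_tendsto_compose[OF _ x])
      qed
      then show "AE t in arc_measure r. (\<lambda>n. f (rot t (x n))) \<longlonglongrightarrow> f (rot t z)" by simp
    qed (use arc_integrable f_ge0 f_le1 in auto)
    then show "(arc_avg r f \<circ> x) \<longlonglongrightarrow> arc_avg r f z"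
      by (simp add: arc_avg_def[abs_def] o_def)
  qed
  then show ?thesis by (simp add: continuous_on_eq_continuous_at)
qed

text \<open>The average is moved from \<open>f\<close> onto \<open>p\<close>: by Fubini and rotation
  invariance, f(rot t z) p(z) integrates like f(z) p(rot (-t) z), which is cis(-mt) f(z) p(z).
  Averaging over t then gives the multiplier at \<open>- m\<close>.\<close>

lemma integral_arc_avg_mult:
  fixes p :: "complex ^ 'n \<Rightarrow> complex"
  assumes p [measurable]: "p \<in> borel_measurable sphere_measure"
    and bound: "AE z in sphere_measure. cmod (p z) \<le> C"
    and p_rot: "\<And>t z. z \<in> usphere \<Longrightarrow> p (rot t z) = cis (of_int m * t) * p z"
  shows "(LINT z|sphere_measure. of_real (arc_avg r f z) * p z)
    = arc_mult r (- m) * (LINT z|sphere_measure. of_real (f z) * p z)"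
proof -
  interpret S: prob_space "sphere_measure :: (complex ^ 'n) measure"
    by (rule prob_space_sphere_measure)
  interpret P: pair_sigma_finite "sphere_measure :: (complex ^ 'n) measure" "arc_measure r" ..
  have f_meas [measurable]: "f \<in> borel_measurable sphere_measure"
    by (intro borel_measurable_sphere_measureI borel_measurable_continuous_onI f_cont)
  have meas_pair: "(\<lambda>(z, t). f (rot t z)) \<in> borel_measurable (sphere_measure \<Otimes>\<^sub>M arc_measure r)"
  proof -
    have "continuous_on UNIV (\<lambda>x. f (rot (snd x) (fst x)))"
      by (intro continuous_on_compose2[OF f_cont] continuous_intros) auto
    then have "(\<lambda>x. f (rot (snd x) (fst x))) \<in> borel_measurable borel"
      by (rule borel_measurable_continuous_onI)
    moreover have "(\<lambda>z. z) \<in> borel_measurable (sphere_measure :: (complex ^ 'n) measure)"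
      by (intro borel_measurable_sphere_measureI) simp
    then have "(\<lambda>x. (fst x, snd x)) \<in> borel_measurable ((sphere_measure :: (complex ^ 'n) measure) \<Otimes>\<^sub>M arc_measure r)"
      by (intro borel_measurable_Pair measurable_compose[OF measurable_fst]
          measurable_compose[OF measurable_snd]) auto
    ultimately have "(\<lambda>x. f (rot (snd (fst x, snd x)) (fst (fst x, snd x))))
        \<in> borel_measurable ((sphere_measure :: (complex ^ 'n) measure) \<Otimes>\<^sub>M arc_measure r)"
      by (rule measurable_compose[rotated])
    then show ?thesis by (simp add: case_prod_unfold)
  qed
  let ?g = "\<lambda>z t. of_real (f (rot t z)) * p z"
  have g_meas [measurable]: "(\<lambda>(z, t). ?g z t) \<in> borel_measurable (sphere_measure \<Otimes>\<^sub>M arc_measure r)"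
    using meas_pair by (simp add: case_prod_unfold) measurable
  have g_int: "integrable (arc_measure r) (?g z)" for z
    using arc_integrable by simp
  have int: "integrable (sphere_measure \<Otimes>\<^sub>M arc_measure r) (\<lambda>(z, t). ?g z t)"
  proof (rule P.Fubini_integrable)
    show "integrable sphere_measure (\<lambda>z. LINT t|arc_measure r. norm (case (z, t) of (z, t) \<Rightarrow> ?g z t))"
    proof (rule S.integrable_const_bound[where B=C])
      show "AE z in sphere_measure. norm (LINT t|arc_measure r. norm (case (z, t) of (z, t) \<Rightarrow> ?g z t)) \<le> C"
        using bound
      proof eventually_elim
        case (elim z)
        have "(LINT t|arc_measure r. norm (case (z, t) of (z, t) \<Rightarrow> ?g z t)) = arc_avg r f z * cmod (p z)"
          by (simp add: norm_mult arc_avg_def f_ge0)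
        also have "norm \<dots> \<le> 1 * cmod (p z)"
          using arc_avg_ge0 arc_avg_le1 by (simp add: abs_mult mult_left_le_one_le)
        finally show ?case using elim by simp
      qed
    qed measurable
  qed (use g_int in auto)
  have inner: "(LINT z|sphere_measure. ?g z t)
      = cis (of_int (- m) * t) * (LINT z|sphere_measure. of_real (f z) * p z)" for t
  proof -
    have "(LINT z|sphere_measure. ?g z t)
        = (LINT z|sphere_measure. cis (of_int (- m) * t) * (of_real (f (rot t z)) * p (rot t z)))"
    proof (rule Bochner_Integration.integral_cong)
      fix z :: "complex ^ 'n" assume "z \<in> space sphere_measure"
      then have "p (rot t z) = cis (of_int m * t) * p z"
        by (intro p_rot) (simp add: space_sphere_measure)
      moreover have "cis (of_int (- m) * t) * cis (of_int m * t) = 1"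
        by (simp add: cis_mult)
      ultimately show "?g z t = cis (of_int (- m) * t) * (of_real (f (rot t z)) * p (rot t z))"
        by (metis (no_types, opaque_lifting) mult.assoc mult.commute mult.left_neutral)
    qed simp
    also have "\<dots> = cis (of_int (- m) * t) * (LINT z|sphere_measure. of_real (f (rot t z)) * p (rot t z))"
      by (rule integral_mult_right_zero)
    also have "(LINT z|sphere_measure. of_real (f (rot t z)) * p (rot t z))
        = (LINT z|sphere_measure. of_real (f z) * p z)"
      by (rule integral_sphere_measure_rot) measurable
    finally show ?thesis .
  qed
  have "(LINT z|sphere_measure. of_real (arc_avg r f z) * p z)
      = (LINT z|sphere_measure. (LINT t|arc_measure r. ?g z t))"
    by (simp add: arc_avg_def)
  also have "\<dots> = (LINT t|arc_measure r. (LINT z|sphere_measure. ?g z t))"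
    by (rule P.Fubini_integral[OF int, symmetric])
  also have "\<dots> = arc_mult r (- m) * (LINT z|sphere_measure. of_real (f z) * p z)"
    unfolding inner arc_mult_def by (rule integral_mult_left_zero)
  finally show ?thesis .
qed

end

section \<open>Orthogonality and homogeneous polynomials on circles\<close>

lemma cnj_borel_measurable [measurable]: "cnj \<in> borel_measurable borel"
  by (intro borel_measurable_continuous_onI continuous_intros)

text \<open>Rotation by \<pi>/(m - l) changes the sign of the integrand but not the
  integral.\<close>

lemma integral_isotypic_orthogonal:
  fixes p q :: "complex ^ 'n::finite \<Rightarrow> complex"
  assumes [measurable]: "p \<in> borel_measurable sphere_measure" "q \<in> borel_measurable sphere_measure"
    and p_rot: "\<And>t z. z \<in> usphere \<Longrightarrow> p (rot t z) = cis (of_int m * t) * p z"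
    and q_rot: "\<And>t z. z \<in> usphere \<Longrightarrow> q (rot t z) = cis (of_int l * t) * q z"
    and "m \<noteq> l"
  shows "(LINT z|sphere_measure. p z * cnj (q z)) = 0"
proof -
  define t where "t = pi / of_int (m - l)"
  have "of_int m * t - of_int l * t = of_int (m - l) * t"
    by (simp add: left_diff_distrib)
  also have "\<dots> = pi"
    using \<open>m \<noteq> l\<close> by (simp add: t_def)
  finally have "of_int m * t - of_int l * t = pi" .
  then have cis: "cis (of_int m * t) * cnj (cis (of_int l * t)) = - 1"
    by (simp add: cis_cnj cis_mult)
  have "(LINT z|sphere_measure. p z * cnj (q z)) = (LINT z|sphere_measure. p (rot t z) * cnj (q (rot t z)))"
    by (rule integral_sphere_measure_rot[symmetric]) measurable
  also have "\<dots> = (LINT z|sphere_measure. - (p z * cnj (q z)))"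
  proof (rule Bochner_Integration.integral_cong)
    fix z :: "complex ^ 'n" assume "z \<in> space sphere_measure"
    then have "z \<in> usphere" by (simp only: space_sphere_measure)
    then have "p (rot t z) * cnj (q (rot t z))
        = (cis (of_int m * t) * cnj (cis (of_int l * t))) * (p z * cnj (q z))"
      by (simp only: p_rot q_rot complex_cnj_mult mult_ac)
    then show "p (rot t z) * cnj (q (rot t z)) = - (p z * cnj (q z))"
      unfolding cis by simp
  qed simp
  finally show ?thesis by simp
qed

text \<open>Elements of \<open>Hol_homog j\<close> are arbitrary off the sphere, so regularity must
  be taken from a polynomial with the same values on it.\<close>

lemma Hol_homog_continuous:
  assumes "f \<in> Hol_homog j"
  obtains Q where "continuous_on UNIV Q" "\<And>z. z \<in> usphere \<Longrightarrow> f z = Q z"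
proof -
  obtain c where c: "\<And>z. z \<in> usphere \<Longrightarrow>
      f z = (\<Sum>\<alpha>\<in>multi_indices j. c \<alpha> * (\<Prod>i\<in>UNIV. (z $ i) ^ \<alpha> i))"
    using assms by (auto simp: Hol_homog_def)
  show ?thesis
    by (rule that[OF _ c]) (intro continuous_intros)
qed

lemma Hol_homog_measurable:
  assumes "f \<in> Hol_homog j"
  shows "f \<in> borel_measurable sphere_measure"
proof -
  obtain Q where Q: "continuous_on UNIV Q" "\<And>z. z \<in> usphere \<Longrightarrow> f z = Q z"
    using Hol_homog_continuous[OF assms] by blast
  have "Q \<in> borel_measurable sphere_measure"
    by (intro borel_measurable_sphere_measureI borel_measurable_continuous_onI Q)
  moreover have "f \<in> borel_measurable sphere_measure \<longleftrightarrow> Q \<in> borel_measurable sphere_measure"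
    by (rule measurable_cong) (simp only: space_sphere_measure Q)
  ultimately show ?thesis by simp
qed

lemma Hol_homog_rot:
  assumes "f \<in> Hol_homog j" "z \<in> usphere"
  shows "f (rot t z) = cis (real j * t) * f z"
proof -
  obtain c where c: "\<And>z. z \<in> usphere \<Longrightarrow>
      f z = (\<Sum>\<alpha>\<in>multi_indices j. c \<alpha> * (\<Prod>i\<in>UNIV. (z $ i) ^ \<alpha> i))"
    using assms(1) by (auto simp: Hol_homog_def)
  have "rot t z \<in> usphere" using assms(2) by simp
  then have "f (rot t z) = (\<Sum>\<alpha>\<in>multi_indices j. c \<alpha> * (\<Prod>i\<in>UNIV. (rot t z $ i) ^ \<alpha> i))"
    by (rule c)
  also have "\<dots> = (\<Sum>\<alpha>\<in>multi_indices j. cis (real j * t) * (c \<alpha> * (\<Prod>i\<in>UNIV. (z $ i) ^ \<alpha> i)))"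
  proof (rule sum.cong[OF refl])
    fix \<alpha> :: "'a \<Rightarrow> nat" assume "\<alpha> \<in> multi_indices j"
    then have "(\<Prod>i\<in>UNIV. cis t ^ \<alpha> i) = cis t ^ j"
      by (simp add: multi_indices_def flip: power_sum)
    also have "\<dots> = cis (real j * t)" by (rule Complex.DeMoivre)
    finally show "c \<alpha> * (\<Prod>i\<in>UNIV. (rot t z $ i) ^ \<alpha> i) = cis (real j * t) * (c \<alpha> * (\<Prod>i\<in>UNIV. (z $ i) ^ \<alpha> i))"
      by (simp add: power_mult_distrib prod.distrib mult_ac)
  qed
  also have "\<dots> = cis (real j * t) * f z"
    by (simp only: sum_distrib_left c[OF assms(2)])
  finally show ?thesis .
qed

section \<open>Energy estimate for Riesz products on the sphere\<close>

locale riesz_triple =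
  fixes R :: "nat \<Rightarrow> complex ^ 'n::finite \<Rightarrow> complex"
    and J :: "nat \<Rightarrow> nat"
    and a :: "nat \<Rightarrow> complex"
  assumes triple: "Riesz_triple R J a"
begin

lemma J_pos: "k \<ge> 1 \<Longrightarrow> J k > 0"
  using triple by (simp add: Riesz_triple_def)

lemma J_lac: "k \<ge> 1 \<Longrightarrow> 3 * J k \<le> J (Suc k)"
proof -
  assume k: "k \<ge> 1"
  then have "real (J (Suc k)) / real (J k) \<ge> 3"
    using triple by (auto simp: Riesz_triple_def)
  then have "real (3 * J k) \<le> real (J (Suc k))"
    using J_pos[OF k] by (simp add: field_simps)
  then show ?thesis by (simp only: of_nat_le_iff)
qed

lemma a_less: "k \<ge> 1 \<Longrightarrow> cmod (a k) < 1"
  using triple by (simp add: Riesz_triple_def)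

lemma R_homog: "j \<ge> 1 \<Longrightarrow> R j \<in> Hol_homog j"
  using triple by (auto simp: Riesz_triple_def RW_sequence_def)

lemma RJ_homog: "k \<ge> 1 \<Longrightarrow> R (J k) \<in> Hol_homog (J k)"
  using R_homog[of "J k"] J_pos[of k] by simp

text \<open>The norm is an essential supremum, so each bound holds off a null set; countably many k
  allow one null set for all.\<close>

lemma R_bound: "AE z in sphere_measure. \<forall>k\<ge>1. cmod (R (J k) z) \<le> 1"
proof -
  have "AE z in sphere_measure. k \<ge> 1 \<longrightarrow> cmod (R (J k) z) \<le> 1" for k
  proof (cases "k \<ge> 1")
    case True
    then have "Linfty_norm (R (J k)) = 1"
      using triple J_pos[OF True] by (auto simp: Riesz_triple_def RW_sequence_def)
    then have "AE z in sphere_measure. ereal (cmod (R (J k) z)) \<le> 1"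
      unfolding Linfty_norm_def by (metis esssup_AE)
    then show ?thesis by simp
  qed simp
  then show ?thesis by (subst AE_all_countable) blast
qed

text \<open>For z on the sphere, the m-th Fourier coefficient of the partial product along the
  circle t \<mapsto> \<open>rot t z\<close>.\<close>

definition component :: "nat \<Rightarrow> int \<Rightarrow> complex ^ 'n \<Rightarrow> complex" where
  "component N m z = riesz_coeff J (\<lambda>k. a k * R (J k) z / 2) (\<lambda>k. cnj (a k) * cnj (R (J k) z) / 2) N m"

text \<open>The Fourier coefficients of the classical Riesz product with factors 1 + |a_k| cos(j_k
  t), which arises when the polynomials are replaced by their sup norm 1.\<close>

definition bound :: "nat \<Rightarrow> int \<Rightarrow> real" where
  "bound = riesz_coeff J (\<lambda>k. cmod (a k) / 2) (\<lambda>k. cmod (a k) / 2)"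

lemma Riesz_partial_eq_sum: "Riesz_partial R J a N z = (\<Sum>m\<in>freqs J N. component N m z)"
  unfolding Riesz_partial_def component_def sum_riesz_coeff by (intro prod.cong) auto

lemma component_measurable [measurable]: "component N m \<in> borel_measurable sphere_measure"
proof (induction N arbitrary: m)
  case 0
  show ?case by (simp add: component_def[abs_def])
next
  case (Suc N)
  note [measurable] = Suc.IH Hol_homog_measurable[OF RJ_homog[of "Suc N"]]
  have "(\<lambda>z. component N m z + a (Suc N) * R (J (Suc N)) z / 2 * component N (m - int (J (Suc N))) z
      + cnj (a (Suc N)) * cnj (R (J (Suc N)) z) / 2 * component N (m + int (J (Suc N))) z)
      \<in> borel_measurable sphere_measure"
    by measurable
  then show ?case by (simp add: component_def[abs_def])
qed

lemma component_rot:
  assumes "z \<in> usphere"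
  shows "component N m (rot t z) = cis (of_int m * t) * component N m z"
  unfolding component_def riesz_coeff_rotate[symmetric]
  by (rule riesz_coeff_cong) (simp_all add: Hol_homog_rot[OF RJ_homog assms] cis_cnj)

lemma component_bound: "AE z in sphere_measure. \<forall>N m. cmod (component N m z) \<le> bound N m"
  using R_bound
proof eventually_elim
  case (elim z)
  show ?case
    unfolding component_def bound_def
    using elim by (auto intro!: norm_riesz_coeff_le simp: norm_mult norm_divide mult_left_le)
qed

lemma bound_nonneg: "bound N m \<ge> 0"
  unfolding bound_def by (rule riesz_coeff_nonneg) simp

text \<open>Components of different frequencies are orthogonal, so only the diagonal survives, and
  \<open>bound N m\<close> dominates each component on a probability space. The weights
  \<open>\<phi>\<close> leave room for the multipliers of the arc average.\<close>

lemma integral_sq_component_sum_le: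
  fixes \<phi> :: "int \<Rightarrow> complex"
  shows "integrable sphere_measure (\<lambda>z. (cmod (\<Sum>m\<in>freqs J N. \<phi> m * component N m z))\<^sup>2)"
    and "(LINT z|sphere_measure. (cmod (\<Sum>m\<in>freqs J N. \<phi> m * component N m z))\<^sup>2)
      \<le> (\<Sum>m\<in>freqs J N. (bound N m)\<^sup>2 * (cmod (\<phi> m))\<^sup>2)"
proof -
  interpret S: prob_space "sphere_measure :: (complex ^ 'n) measure"
    by (rule prob_space_sphere_measure)
  let ?F = "freqs J N" and ?t = "component N"
  have int: "integrable sphere_measure (\<lambda>z. ?t m z * cnj (?t l z))" for m l
  proof (rule S.integrable_const_bound[where B="bound N m * bound N l"])
    show "AE z in sphere_measure. norm (?t m z * cnj (?t l z)) \<le> bound N m * bound N l"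
      using component_bound
      by eventually_elim (auto simp: norm_mult bound_nonneg intro!: mult_mono)
  qed measurable
  have sq: "complex_of_real ((cmod (\<Sum>m\<in>?F. \<phi> m * ?t m z))\<^sup>2)
      = (\<Sum>m\<in>?F. \<Sum>l\<in>?F. (\<phi> m * cnj (\<phi> l)) * (?t m z * cnj (?t l z)))" for z
    by (simp only: complex_norm_square cnj_sum sum_product complex_cnj_mult mult_ac)
  have "integrable sphere_measure (\<lambda>z. complex_of_real ((cmod (\<Sum>m\<in>?F. \<phi> m * ?t m z))\<^sup>2))"
    unfolding sq by (intro Bochner_Integration.integrable_sum integrable_mult_right int)
  then show "integrable sphere_measure (\<lambda>z. (cmod (\<Sum>m\<in>?F. \<phi> m * ?t m z))\<^sup>2)"
    by (drule_tac integrable_Re) (simp only: Re_complex_of_real)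
  have "complex_of_real (LINT z|sphere_measure. (cmod (\<Sum>m\<in>?F. \<phi> m * ?t m z))\<^sup>2)
      = (LINT z|sphere_measure. complex_of_real ((cmod (\<Sum>m\<in>?F. \<phi> m * ?t m z))\<^sup>2))"
    by (rule integral_complex_of_real[symmetric])
  also have "\<dots> = (\<Sum>m\<in>?F. \<Sum>l\<in>?F. (\<phi> m * cnj (\<phi> l)) * (LINT z|sphere_measure. ?t m z * cnj (?t l z)))"
    unfolding sq
    by (subst Bochner_Integration.integral_sum, (intro Bochner_Integration.integrable_sum integrable_mult_right int)[1],
        subst Bochner_Integration.integral_sum, (intro integrable_mult_right int)[1])
      (simp only: integral_mult_right_zero)
  also have "\<dots> = (\<Sum>m\<in>?F. \<Sum>l\<in>?F. if l = m then (\<phi> m * cnj (\<phi> m)) * (LINT z|sphere_measure. ?t m z * cnj (?t m z)) else 0)"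
  proof (intro sum.cong refl)
    fix m l
    have "(LINT z|sphere_measure. ?t m z * cnj (?t l z)) = 0" if "l \<noteq> m"
      by (rule integral_isotypic_orthogonal[OF component_measurable component_measurable component_rot component_rot])
        (use that in auto)
    then show "(\<phi> m * cnj (\<phi> l)) * (LINT z|sphere_measure. ?t m z * cnj (?t l z))
      = (if l = m then (\<phi> m * cnj (\<phi> m)) * (LINT z|sphere_measure. ?t m z * cnj (?t m z)) else 0)"
      by auto
  qed
  also have "\<dots> = (\<Sum>m\<in>?F. (\<phi> m * cnj (\<phi> m)) * (LINT z|sphere_measure. ?t m z * cnj (?t m z)))"
    by (simp add: sum.delta)
  also have "\<dots> = complex_of_real (\<Sum>m\<in>?F. (cmod (\<phi> m))\<^sup>2 * (LINT z|sphere_measure. (cmod (?t m z))\<^sup>2))"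
    by (simp only: complex_norm_square[symmetric] integral_complex_of_real of_real_sum of_real_mult)
  finally have "(LINT z|sphere_measure. (cmod (\<Sum>m\<in>?F. \<phi> m * ?t m z))\<^sup>2)
      = (\<Sum>m\<in>?F. (cmod (\<phi> m))\<^sup>2 * (LINT z|sphere_measure. (cmod (?t m z))\<^sup>2))"
    by (simp only: of_real_eq_iff)
  also have "\<dots> \<le> (\<Sum>m\<in>?F. (cmod (\<phi> m))\<^sup>2 * (bound N m)\<^sup>2)"
  proof (intro sum_mono mult_left_mono)
    fix m
    have b: "AE z in sphere_measure. (cmod (?t m z))\<^sup>2 \<le> (bound N m)\<^sup>2"
      using component_bound by eventually_elim (simp add: power_mono)
    have "integrable sphere_measure (\<lambda>z. (cmod (?t m z))\<^sup>2)"
      by (rule S.integrable_const_bound[where B="(bound N m)\<^sup>2"]) (use b in auto)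
    then have "(LINT z|sphere_measure. (cmod (?t m z))\<^sup>2) \<le> (LINT z|(sphere_measure :: (complex ^ 'n) measure). (bound N m)\<^sup>2)"
      using b by (intro integral_mono_AE) auto
    then show "(LINT z|sphere_measure. (cmod (?t m z))\<^sup>2) \<le> (bound N m)\<^sup>2"
      using S.prob_space by simp
  qed simp
  finally show "(LINT z|sphere_measure. (cmod (\<Sum>m\<in>?F. \<phi> m * ?t m z))\<^sup>2)
      \<le> (\<Sum>m\<in>?F. (bound N m)\<^sup>2 * (cmod (\<phi> m))\<^sup>2)"
    by (simp only: mult.commute)
qed

definition energy_const :: "real \<Rightarrow> real" where
  "energy_const \<alpha> = 1 + 2 powr \<alpha> * (\<Sum>k. riesz_block a (Suc k) * real (J (Suc k)) powr - \<alpha>)"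

text \<open>The weighted coefficient estimate with D = r^(-\<alpha>) and \<beta> k = |a k| / 2. As r
  \<le> 1, the undamped frequency 0 is absorbed into r^(-\<alpha>).\<close>

lemma sum_bound_sq_arc_mult_le:
  assumes \<alpha>: "0 < \<alpha>" "\<alpha> \<le> 2" and r: "0 < r" "r \<le> 1"
    and sum: "summable (\<lambda>k. riesz_block a k * real (J k) powr - \<alpha>)"
  shows "(\<Sum>m\<in>freqs J N. (bound N m)\<^sup>2 * (cmod (arc_mult r (- m)))\<^sup>2) \<le> energy_const \<alpha> * r powr - \<alpha>"
proof -
  let ?g = "\<lambda>k. riesz_block a k * real (J k) powr - \<alpha>"
  have r1: "r powr - \<alpha> \<ge> 1"
    using r \<alpha> powr_mono2'[of "- \<alpha>" r 1] by simp
  have "(\<Sum>m\<in>freqs J N. (bound N m)\<^sup>2 * (cmod (arc_mult r (- m)))\<^sup>2)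
    \<le> 1 + r powr - \<alpha> * 2 powr \<alpha> *
        (\<Sum>k=1..N. 2 * (cmod (a k) / 2)\<^sup>2 * (\<Prod>l=1..<k. 1 + 2 * (cmod (a l) / 2)\<^sup>2) * real (J k) powr - \<alpha>)"
    unfolding bound_def
  proof (rule sum_riesz_coeff_sq_weighted_le)
    show "J k > 0" "3 * J k \<le> J (Suc k)" if "k \<ge> 1" for k
      using that by (auto intro: J_pos J_lac)
    show "(cmod (arc_mult r (- 0)))\<^sup>2 \<le> 1"
      using cmod_arc_mult_le_1[OF r(1)] by (simp add: power_le_one)
    show "(cmod (arc_mult r (- m)))\<^sup>2 \<le> r powr - \<alpha> * real_of_int \<bar>m\<bar> powr - \<alpha>" if "m \<noteq> 0" for m
      using cmod_arc_mult_sq_le[of r "- m" \<alpha>] that r \<alpha> by simp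
  qed (use \<alpha> in auto)
  also have "(\<Sum>k=1..N. 2 * (cmod (a k) / 2)\<^sup>2 * (\<Prod>l=1..<k. 1 + 2 * (cmod (a l) / 2)\<^sup>2) * real (J k) powr - \<alpha>)
      = (\<Sum>k=1..N. ?g k)"
    by (simp add: riesz_block_def power_divide)
  also have "(\<Sum>k=1..N. ?g k) = (\<Sum>k<N. ?g (Suc k))"
    by (simp add: sum.atLeast1_atMost_eq)
  also have "\<dots> \<le> (\<Sum>k. ?g (Suc k))"
    using summable_Suc_iff[THEN iffD2, OF sum]
    by (intro sum_le_suminf) (auto simp: riesz_block_nonneg)
  finally have "(\<Sum>m\<in>freqs J N. (bound N m)\<^sup>2 * (cmod (arc_mult r (- m)))\<^sup>2)
      \<le> 1 + r powr - \<alpha> * 2 powr \<alpha> * (\<Sum>k. ?g (Suc k))"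
    by (simp add: mult_left_mono)
  also have "\<dots> \<le> energy_const \<alpha> * r powr - \<alpha>"
    using r1 by (simp add: energy_const_def algebra_simps)
  finally show ?thesis .
qed

lemma energy_const_pos:
  assumes "summable (\<lambda>k. riesz_block a k * real (J k) powr - \<alpha>)"
  shows "energy_const \<alpha> > 0"
  unfolding energy_const_def using summable_Suc_iff[THEN iffD2, OF assms]
  by (intro add_pos_nonneg mult_nonneg_nonneg suminf_nonneg) (auto simp: riesz_block_nonneg)

text \<open>Almost everywhere |a_k R_{j_k}| \<le> 1, so no factor is negative. Hence
  \<open>ennreal\<close> does not truncate the density, and integrals against the partial measures
  become integrals over the sphere.\<close>

lemma Riesz_partial_nonneg:
  "AE z in sphere_measure. Riesz_partial R J a N z = of_real (Re (Riesz_partial R J a N z))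
     \<and> 0 \<le> Re (Riesz_partial R J a N z)"
  using R_bound
proof eventually_elim
  case (elim z)
  have "Riesz_partial R J a N z = (\<Prod>k=1..N. complex_of_real (1 + Re (a k * R (J k) z)))"
    unfolding Riesz_partial_def by (intro prod.cong) (auto simp: complex_eq_iff field_simps)
  then have eq: "Riesz_partial R J a N z = complex_of_real (\<Prod>k=1..N. 1 + Re (a k * R (J k) z))"
    by (simp only: of_real_prod)
  have nonneg: "0 \<le> (\<Prod>k=1..N. 1 + Re (a k * R (J k) z))"
  proof (rule prod_nonneg)
    fix k assume k: "k \<in> {1..N}"
    then have "cmod (a k * R (J k) z) \<le> 1 * 1"
      unfolding norm_mult using elim a_less[of k] by (intro mult_mono) auto
    then show "0 \<le> 1 + Re (a k * R (J k) z)"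
      using abs_Re_le_cmod[of "a k * R (J k) z"] by linarith
  qed
  show ?case
    unfolding eq using nonneg by (simp only: Re_complex_of_real simp_thms)
qed

lemma Riesz_partial_measurable [measurable]: "Riesz_partial R J a N \<in> borel_measurable sphere_measure"
  unfolding Riesz_partial_eq_sum[abs_def] by measurable

text \<open>Moving the average onto each component turns the partial product into \<open>X\<close>,
  whose L^2 norm is under control. A free parameter \<open>c\<close> replaces Cauchy-Schwarz, which
  is recovered by optimizing it.\<close>

lemma integral_Riesz_partial_arc_avg_le:
  fixes f :: "complex ^ 'n \<Rightarrow> real"
  assumes f: "continuous_on UNIV f" "\<And>z. 0 \<le> f z" "\<And>z. f z \<le> 1"
    and \<alpha>: "0 < \<alpha>" "\<alpha> \<le> 2" and r: "0 < r" "r \<le> 1"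
    and sum: "summable (\<lambda>k. riesz_block a k * real (J k) powr - \<alpha>)"
    and c: "c > 0"
  shows "(LINT z|Riesz_partial_measure R J a N. arc_avg r f z)
    \<le> (c * (LINT z|sphere_measure. f z) + energy_const \<alpha> * r powr - \<alpha> / c) / 2"
proof -
  interpret S: prob_space "sphere_measure :: (complex ^ 'n) measure"
    by (rule prob_space_sphere_measure)
  let ?F = "freqs J N" and ?t = "component N"
  define X where "X z = (\<Sum>m\<in>?F. arc_mult r (- m) * ?t m z)" for z
  have f_meas [measurable]: "f \<in> borel_measurable sphere_measure"
    by (intro borel_measurable_sphere_measureI borel_measurable_continuous_onI f)
  have avg_meas [measurable]: "arc_avg r f \<in> borel_measurable sphere_measure"
    by (intro borel_measurable_sphere_measureI borel_measurable_continuous_onI continuous_arc_avg f r)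
  have f_int: "integrable sphere_measure f"
    by (rule S.integrable_const_bound[where B=1]) (use f in auto)
  have t_int: "integrable sphere_measure (\<lambda>z. complex_of_real (h z) * ?t m z)"
    if [measurable]: "h \<in> borel_measurable sphere_measure" and h: "\<And>z. 0 \<le> h z \<and> h z \<le> 1" for h m
  proof (rule S.integrable_const_bound[where B="bound N m"])
    show "AE z in sphere_measure. norm (complex_of_real (h z) * ?t m z) \<le> bound N m"
      using component_bound
      by eventually_elim (use h in \<open>auto simp: norm_mult intro!: order_trans[OF mult_left_le_one_le]\<close>)
  qed measurable
  have avg: "0 \<le> arc_avg r f z" "arc_avg r f z \<le> 1" for z
    using arc_avg_ge0[OF f r(1)] arc_avg_le1[OF f r(1)] by auto
  have "complex_of_real (LINT z|Riesz_partial_measure R J a N. arc_avg r f z)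
      = complex_of_real (LINT z|sphere_measure. Re (Riesz_partial R J a N z) *\<^sub>R arc_avg r f z)"
    unfolding Riesz_partial_measure_def
    using Riesz_partial_nonneg[of N] by (subst integral_density) auto
  also have "\<dots> = (LINT z|sphere_measure. of_real (arc_avg r f z) * Riesz_partial R J a N z)"
    unfolding integral_complex_of_real[symmetric]
  proof (rule integral_cong_AE)
    show "AE z in sphere_measure. complex_of_real (Re (Riesz_partial R J a N z) *\<^sub>R arc_avg r f z)
        = of_real (arc_avg r f z) * Riesz_partial R J a N z"
      using Riesz_partial_nonneg[of N] by eventually_elim (metis mult.commute of_real_mult real_scaleR_def)
  qed measurable
  also have "\<dots> = (\<Sum>m\<in>?F. LINT z|sphere_measure. of_real (arc_avg r f z) * ?t m z)"
    unfolding Riesz_partial_eq_sum sum_distrib_left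
    by (rule Bochner_Integration.integral_sum) (auto intro!: t_int avg)
  also have "\<dots> = (\<Sum>m\<in>?F. arc_mult r (- m) * (LINT z|sphere_measure. of_real (f z) * ?t m z))"
  proof (intro sum.cong refl integral_arc_avg_mult[OF f r(1)])
    fix m show "AE z in sphere_measure. cmod (?t m z) \<le> bound N m"
      using component_bound by eventually_elim simp
  qed (auto intro: component_rot)
  also have "\<dots> = (\<Sum>m\<in>?F. LINT z|sphere_measure. arc_mult r (- m) * (of_real (f z) * ?t m z))"
    by (simp only: integral_mult_right_zero)
  also have "\<dots> = (LINT z|sphere_measure. (\<Sum>m\<in>?F. arc_mult r (- m) * (of_real (f z) * ?t m z)))"
    by (rule Bochner_Integration.integral_sum[symmetric], intro integrable_mult_right t_int)
      (auto simp: f)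
  also have "\<dots> = (LINT z|sphere_measure. of_real (f z) * X z)"
    by (simp add: X_def sum_distrib_left mult.left_commute)
  finally have "complex_of_real (LINT z|Riesz_partial_measure R J a N. arc_avg r f z)
      = (LINT z|sphere_measure. of_real (f z) * X z)" .
  then have "(LINT z|Riesz_partial_measure R J a N. arc_avg r f z)
      \<le> cmod (LINT z|sphere_measure. of_real (f z) * X z)"
    by (metis abs_ge_self norm_of_real)
  also have "\<dots> \<le> (LINT z|sphere_measure. cmod (of_real (f z) * X z))"
    by (rule integral_norm_bound)
  also have "\<dots> \<le> (LINT z|sphere_measure. (c * f z + (cmod (X z))\<^sup>2 / c) / 2)"
  proof (rule integral_mono')
    show "integrable sphere_measure (\<lambda>z. (c * f z + (cmod (X z))\<^sup>2 / c) / 2)"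
      using f_int integral_sq_component_sum_le(1)[where N=N and \<phi>="\<lambda>m. arc_mult r (- m)"] by (simp add: X_def)
    fix z
    \<comment> \<open>Arithmetic-geometric mean: 2 f |X| \<le> c f^2 + |X|^2 / c. Since f takes
      values in [0, 1], f^2 \<le> f, and the integral of f measures the union of balls.\<close>
    have "0 \<le> (c * f z - cmod (X z))\<^sup>2" by simp
    then have "2 * c * (f z * cmod (X z)) \<le> c\<^sup>2 * (f z)\<^sup>2 + (cmod (X z))\<^sup>2"
      by (simp add: power2_eq_square algebra_simps)
    also have "(f z)\<^sup>2 \<le> f z"
      using f(2,3)[of z] by (simp add: power2_eq_square mult_left_le)
    then have "c\<^sup>2 * (f z)\<^sup>2 + (cmod (X z))\<^sup>2 \<le> c\<^sup>2 * f z + (cmod (X z))\<^sup>2"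
      by (simp add: mult_left_mono)
    finally have "2 * (f z * cmod (X z)) \<le> c * f z + (cmod (X z))\<^sup>2 / c"
      using c by (simp add: field_simps power2_eq_square)
    then show "cmod (of_real (f z) * X z) \<le> (c * f z + (cmod (X z))\<^sup>2 / c) / 2"
      using f(2)[of z] by (simp add: norm_mult)
    show "0 \<le> (c * f z + (cmod (X z))\<^sup>2 / c) / 2" using c f(2)[of z] by simp
  qed
  also have "\<dots> = (c * (LINT z|sphere_measure. f z) + (LINT z|sphere_measure. (cmod (X z))\<^sup>2) / c) / 2"
    using f_int integral_sq_component_sum_le(1)[where N=N and \<phi>="\<lambda>m. arc_mult r (- m)"] by (simp add: X_def)
  also have "\<dots> \<le> (c * (LINT z|sphere_measure. f z) + energy_const \<alpha> * r powr - \<alpha> / c) / 2"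
    using c order_trans[OF integral_sq_component_sum_le(2)[where N=N and \<phi>="\<lambda>m. arc_mult r (- m)"]
        sum_bound_sq_arc_mult_le[OF \<alpha> r sum, of N]]
    by (simp add: X_def divide_right_mono)
  finally show ?thesis .
qed

end

section \<open>Mass of finite unions of balls\<close>

context riesz_triple
begin

lemma measure_Riesz_product_balls_le:
  assumes \<mu>: "is_Riesz_product R J a \<mu>"
    and \<alpha>: "0 < \<alpha>" "\<alpha> \<le> 2" and r: "0 < r" "r \<le> 1"
    and sum: "summable (\<lambda>k. riesz_block a k * real (J k) powr - \<alpha>)"
    and X: "finite X" "X \<subseteq> usphere"
  shows "measure \<mu> ((\<Union>x\<in>X. cball x r) \<inter> usphere)
    \<le> sqrt (4 * 2 ^ (2 * CARD('n)) * 3 ^ (2 * CARD('n) - 1) * energy_const \<alpha>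
        * real (card X) * r powr (2 * real CARD('n) - 1 - \<alpha>))"
proof (cases "X = {}")
  \<comment> \<open>The empty set is set apart: \<open>infdist\<close> to it is 0 by convention,
    which would make \<open>f\<close> below identically 1.\<close>
  case False
  interpret prob_space \<mu>
    using \<mu> by (simp add: is_Riesz_product_def)
  interpret S: prob_space "sphere_measure :: (complex ^ 'n) measure"
    by (rule prob_space_sphere_measure)
  have sets_\<mu>: "sets \<mu> = sets (sphere_measure :: (complex ^ 'n) measure)"
    using \<mu> by (simp add: is_Riesz_product_def sets_sphere_measure)
  have space_\<mu>: "space \<mu> = usphere"
    using sets_eq_imp_space_eq[OF sets_\<mu>] by (simp only: space_sphere_measure)
  let ?d = "2 * CARD('n) - 1"
  let ?G = "(\<Union>x\<in>X. cball x r) \<inter> usphere"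
  \<comment> \<open>\<open>f\<close> is 1 within distance 2r of \<open>X\<close> and 0 from distance
    3r on. An arc of radius r around a point of the balls stays within 2r of \<open>X\<close>, so
    the average is exactly 1 there; the support radius 3r produces the factor 3^(2n-1).\<close>
  define f where "f z = max 0 (min 1 (3 - infdist z X / r))" for z :: "complex ^ 'n"
  have f: "continuous_on UNIV f" "\<And>z. 0 \<le> f z" "\<And>z. f z \<le> 1"
    unfolding f_def using r by (auto intro!: continuous_intros)
  have avg_meas [measurable]: "arc_avg r f \<in> borel_measurable \<mu>"
    unfolding measurable_cong_sets[OF sets_\<mu> refl]
    by (intro borel_measurable_sphere_measureI borel_measurable_continuous_onI continuous_arc_avg f r)
  have avg: "0 \<le> arc_avg r f z" "arc_avg r f z \<le> 1" for z
    using arc_avg_ge0[OF f r(1)] arc_avg_le1[OF f r(1)] by auto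
  have G [measurable]: "?G \<in> sets \<mu>"
    unfolding sets_\<mu> sets_sphere_measure_iff using X
    by (auto intro!: sets.Int borel_closed closed_UN)
  have avg_int: "integrable \<mu> (arc_avg r f)"
    by (rule integrable_const_bound[where B=1]) (use avg in auto)
  have "measure \<mu> ?G = (LINT z|\<mu>. indicator ?G z)"
    using G by simp
  also have "\<dots> \<le> (LINT z|\<mu>. arc_avg r f z)"
  proof (rule integral_mono)
    fix z assume "z \<in> space \<mu>"
    show "indicator ?G z \<le> arc_avg r f z"
    proof (cases "z \<in> ?G")
      case True
      then obtain x where x: "x \<in> X" "dist x z \<le> r" and z: "z \<in> usphere" by auto
      have "f w = 1" if "dist w z \<le> r" for w
      proof -
        have "infdist w X \<le> dist w x" by (rule infdist_le[OF x(1)])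
        also have "\<dots> \<le> 2 * r" using dist_triangle[of w x z] that x(2) by (simp add: dist_commute)
        finally have "infdist w X / r \<le> 2" using r by (simp add: divide_le_eq)
        then show ?thesis by (simp add: f_def)
      qed
      then have "arc_avg r f z = 1" by (intro arc_avg_eq_1[OF f r(1) z]) auto
      then show ?thesis by simp
    qed (simp add: avg)
  next
    show "integrable \<mu> (indicator ?G :: _ \<Rightarrow> real)"
      by (rule integrable_const_bound[where B=1]) (auto simp: indicator_def)
  qed (rule avg_int)
  finally have \<mu>_le: "measure \<mu> ?G \<le> (LINT z|\<mu>. arc_avg r f z)" .

  define A where "A = real (card X) * (4 * 2 ^ (2 * CARD('n)) * (3 * r) ^ ?d)"
  have A: "A > 0" using False X r by (simp add: A_def card_gt_0_iff)
  have f_le: "(LINT z|sphere_measure. f z) \<le> A"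
  proof -
    have ball_sets: "ball x (3 * r) \<inter> usphere \<in> sets sphere_measure" for x :: "complex ^ 'n"
      by (simp add: sets_sphere_measure_iff)
    have ind_int: "integrable sphere_measure (indicator (ball x (3 * r) \<inter> usphere) :: _ \<Rightarrow> real)"
      for x :: "complex ^ 'n"
      by (rule S.integrable_const_bound[where B=1])
        (auto simp: indicator_def ball_sets intro: borel_measurable_indicator)
    have "(LINT z|sphere_measure. f z)
        \<le> (LINT z|sphere_measure. (\<Sum>x\<in>X. indicator (ball x (3 * r) \<inter> usphere) z))"
    proof (rule integral_mono')
      show "integrable sphere_measure (\<lambda>z. \<Sum>x\<in>X. indicator (ball x (3 * r) \<inter> usphere) z :: real)"
        by (intro Bochner_Integration.integrable_sum ind_int)
      fix z :: "complex ^ 'n" assume z: "z \<in> space sphere_measure"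
      show "f z \<le> (\<Sum>x\<in>X. indicator (ball x (3 * r) \<inter> usphere) z)"
      proof (cases "f z = 0")
        case True
        then show ?thesis by (simp add: sum_nonneg)
      next
        case f_pos: False
        obtain x where x: "x \<in> X" "infdist z X = dist z x"
          using infdist_attains_inf[OF finite_imp_closed[OF X(1)] False] by blast
        have "3 - infdist z X / r > 0" using f_pos by (rule contrapos_np) (simp add: f_def)
        then have "dist z x < 3 * r" using x r by (simp add: divide_less_eq)
        then have "z \<in> ball x (3 * r) \<inter> usphere"
          using z by (simp add: space_sphere_measure dist_commute)
        then have "f z \<le> indicator (ball x (3 * r) \<inter> usphere) z" using f(3) by simp
        also have "\<dots> \<le> (\<Sum>x\<in>X. indicator (ball x (3 * r) \<inter> usphere) z)"
          by (rule member_le_sum) (use x X in auto)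
        finally show ?thesis .
      qed
    qed (simp add: sum_nonneg)
    also have "\<dots> = (\<Sum>x\<in>X. measure sphere_measure (ball x (3 * r) \<inter> usphere))"
      by (subst Bochner_Integration.integral_sum, rule ind_int)
        (simp add: space_sphere_measure Int_assoc)
    also have "\<dots> \<le> (\<Sum>x\<in>X. 4 * 2 ^ (2 * CARD('n)) * (3 * r) ^ ?d)"
      using X r by (intro sum_mono measure_sphere_measure_ball_le) auto
    finally show ?thesis by (simp add: A_def)
  qed
  define D where "D = energy_const \<alpha> * r powr - \<alpha>"
  have D: "D > 0" using energy_const_pos[OF sum] r by (simp add: D_def)
  have "(LINT z|\<mu>. arc_avg r f z) \<le> sqrt (A * D)"
  proof (rule LIMSEQ_le_const2)
    \<comment> \<open>Test functions of the weak-star limit are complex-valued, so the real average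
      is embedded and the limit read back.\<close>
    have "continuous_on usphere (\<lambda>z. complex_of_real (arc_avg r f z))"
      by (intro continuous_intros continuous_on_subset[OF continuous_arc_avg[OF f r(1)]]) auto
    then have "(\<lambda>N. LINT z|Riesz_partial_measure R J a N. complex_of_real (arc_avg r f z))
        \<longlonglongrightarrow> (LINT z|\<mu>. complex_of_real (arc_avg r f z))"
      using \<mu> unfolding is_Riesz_product_def weak_star_limit_def by blast
    then show "(\<lambda>N. LINT z|Riesz_partial_measure R J a N. arc_avg r f z)
        \<longlonglongrightarrow> (LINT z|\<mu>. arc_avg r f z)"
      by (simp only: integral_complex_of_real tendsto_of_real_iff)
    have "(LINT z|Riesz_partial_measure R J a N. arc_avg r f z) \<le> sqrt (A * D)" for N
    proof -
      define u where "u = sqrt A"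
      define v where "v = sqrt D"
      have uv: "u > 0" "v > 0" "A = u * u" "D = v * v" "sqrt (A * D) = u * v"
        using A D by (simp_all add: u_def v_def real_sqrt_mult)
      \<comment> \<open>The minimizing choice sqrt(D / A), for which \<open>c * A\<close> and
        \<open>D / c\<close> both equal sqrt(A D).\<close>
      define c where "c = v / u"
      have c: "c > 0" using uv by (simp add: c_def)
      have "(LINT z|Riesz_partial_measure R J a N. arc_avg r f z)
          \<le> (c * (LINT z|sphere_measure. f z) + D / c) / 2"
        unfolding D_def by (rule integral_Riesz_partial_arc_avg_le[OF f \<alpha> r sum c])
      also have "\<dots> \<le> (c * A + D / c) / 2"
        using c f_le by (simp add: mult_left_mono)
      also have "c * A = sqrt (A * D)"
        unfolding uv(5) using uv(1) by (simp add: c_def uv(3))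
      also have "D / c = sqrt (A * D)"
        unfolding uv(5) using uv(2) by (simp add: c_def uv(4))
      finally show ?thesis by simp
    qed
    then show "\<exists>M. \<forall>N\<ge>M. (LINT z|Riesz_partial_measure R J a N. arc_avg r f z) \<le> sqrt (A * D)"
      by blast
  qed
  also have "A * D = 4 * 2 ^ (2 * CARD('n)) * 3 ^ ?d * energy_const \<alpha>
        * real (card X) * r powr (2 * real CARD('n) - 1 - \<alpha>)"
  proof -
    have "2 * CARD('n) \<ge> 1" using zero_less_card_finite[where 'a='n] by linarith
    then have "real ?d = 2 * real CARD('n) - 1" by (simp add: of_nat_diff)
    then have "r ^ ?d * r powr - \<alpha> = r powr (2 * real CARD('n) - 1 - \<alpha>)"
      using r by (simp add: powr_realpow[symmetric] flip: powr_add)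
    moreover have "A * D = 4 * 2 ^ (2 * CARD('n)) * 3 ^ ?d * energy_const \<alpha> * real (card X) * (r ^ ?d * r powr - \<alpha>)"
      by (simp add: A_def D_def power_mult_distrib)
    ultimately show ?thesis by (simp only:)
  qed
  finally show ?thesis using \<mu>_le by linarith
qed simp

end

section \<open>Hausdorff null sets\<close>

text \<open>For d > 0 take the smallest dyadic number that is at least d; it is at most 2d. For d =
  0 no smallest one exists, and the slack \<open>e\<close> pays for a sufficiently large m.\<close>

lemma dyadic_scale:
  fixes d s e :: real
  assumes "0 \<le> d" "d \<le> 1" "0 < s" "0 < e"
  shows "\<exists>m. d \<le> (1/2) ^ m \<and> ((1/2) ^ m) powr s \<le> 2 powr s * d powr s + e"
proof (cases "d = 0")
  case True
  have "(1/2::real) powr s < 1" using assms by (simp add: powr01_less_one)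
  then obtain m where "((1/2::real) powr s) ^ m < e"
    using real_arch_pow_inv[OF assms(4)] by blast
  moreover have "((1/2::real) ^ m) powr s = ((1/2) powr s) ^ m"
    by (simp add: powr_realpow[symmetric] powr_powr mult.commute)
  ultimately show ?thesis using True by (intro exI[of _ m]) simp
next
  case False
  then have d: "d > 0" using assms by simp
  define k where "k = (LEAST k. (1/2::real) ^ k < d)"
  have ex: "\<exists>k. (1/2::real) ^ k < d" using real_arch_pow_inv[OF d] by auto
  have k: "(1/2::real) ^ k < d" unfolding k_def by (rule LeastI_ex[OF ex])
  then have "k \<noteq> 0" using assms(2) by (intro notI) simp
  then obtain m where m: "k = Suc m" by (cases k) auto
  then have 1: "d \<le> (1/2) ^ m"
    using not_less_Least[of m "\<lambda>k. (1/2::real) ^ k < d"] by (simp add: k_def)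
  have "(1/2) ^ m \<le> 2 * d" using k m by simp
  then have "((1/2) ^ m) powr s \<le> (2 * d) powr s" using assms by (intro powr_mono2) auto
  then have "((1/2) ^ m) powr s \<le> 2 powr s * d powr s + e"
    using assms by (simp add: powr_mult)
  with 1 show ?thesis by blast
qed

text \<open>The bound for finite unions of balls grows only like the square root of the number of balls;
  sorting a cover by dyadic diameter makes this sufficient, as each class is estimated at once.\<close>

lemma hausdorff_null_imp_null:
  fixes \<mu> :: "'a::metric_space measure"
  assumes "finite_measure \<mu>"
    and balls: "\<And>X r. finite X \<Longrightarrow> X \<subseteq> space \<mu> \<Longrightarrow> 0 < r \<Longrightarrow> r \<le> 1 \<Longrightarrow>
      (\<Union>x\<in>X. cball x r) \<inter> space \<mu> \<in> sets \<mu> \<and>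
      measure \<mu> ((\<Union>x\<in>X. cball x r) \<inter> space \<mu>) \<le> sqrt (M * real (card X) * r powr t)"
    and M: "M \<ge> 0" and s: "0 < s" "s < t"
    and E: "E \<in> sets \<mu>" and null: "hausdorff_outer_measure s E = 0"
  shows "emeasure \<mu> E = 0"
proof -
  interpret finite_measure \<mu> by fact
  \<comment> \<open>The square root of the factor gained in r^(t-s) when r is halved: the ratio of
    the geometric series over the dyadic classes.\<close>
  define q where "q = sqrt ((1/2) powr (t - s))"
  have q: "0 \<le> q" "q < 1"
    using s by (auto simp: q_def powr01_less_one)
  have bound: "measure \<mu> E \<le> sqrt (M * ((2 powr s + 2) * e)) / (1 - q)" if e: "e > 0" for e
  proof -
    \<comment> \<open>Scale 1 supplies covers with diameters at most 1, as the passage to dyadic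
      diameters demands.\<close>
    have "hausdorff_premeasure s 1 E \<le> hausdorff_outer_measure s E"
      unfolding hausdorff_outer_measure_def by (rule SUP_upper) simp
    then have "hausdorff_premeasure s 1 E < ennreal e"
      using null e by simp
    then obtain U :: "nat \<Rightarrow> 'a set" where U: "E \<subseteq> (\<Union>i. U i)" "\<And>i. bounded (U i)" "\<And>i. diameter (U i) \<le> 1"
      and U_sum: "(\<Sum>i. ennreal (diameter (U i) powr s)) < ennreal e"
      unfolding hausdorff_premeasure_def INF_less_iff by auto
    have "\<exists>m. diameter (U i) \<le> (1/2) ^ m \<and>
        ((1/2) ^ m) powr s \<le> 2 powr s * diameter (U i) powr s + e * (1/2) ^ i" for i
      by (rule dyadic_scale) (use U e s diameter_ge_0 in auto)
    then obtain m where m: "\<And>i. diameter (U i) \<le> (1/2) ^ m i"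
      and m_s: "\<And>i. ((1/2) ^ m i) powr s \<le> 2 powr s * diameter (U i) powr s + e * (1/2) ^ i"
      by metis
    \<comment> \<open>The factor 2^s comes from rounding diameters up to dyadic ones, the summand 2
      from the errors e (1/2)^i added over all i.\<close>
    define e' where "e' = (2 powr s + 2) * e"
    have total: "(\<Sum>i\<in>I. ((1/2) ^ m i) powr s) \<le> e'" if I: "finite I" for I
    proof -
      have "ennreal (\<Sum>i\<in>I. ((1/2) ^ m i) powr s) = (\<Sum>i\<in>I. ennreal (((1/2) ^ m i) powr s))"
        by (rule sum_ennreal[symmetric]) simp
      also have "\<dots> \<le> (\<Sum>i\<in>I. ennreal (2 powr s) * ennreal (diameter (U i) powr s) + ennreal (e * (1/2) ^ i))"
        using m_s e by (intro sum_mono) (simp flip: ennreal_mult'' ennreal_plus)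
      also have "\<dots> \<le> (\<Sum>i. ennreal (2 powr s) * ennreal (diameter (U i) powr s) + ennreal (e * (1/2) ^ i))"
        using I by (intro sum_le_suminf) auto
      also have "\<dots> = ennreal (2 powr s) * (\<Sum>i. ennreal (diameter (U i) powr s)) + (\<Sum>i. ennreal (e * (1/2) ^ i))"
        by (simp add: suminf_add[symmetric])
      also have "(\<Sum>i. ennreal (e * (1/2) ^ i)) = ennreal (e * 2)"
        using e geometric_sums[of "1/2::real"]
        by (intro suminf_ennreal_eq sums_mult) (auto simp: field_simps)
      also have "ennreal (2 powr s) * (\<Sum>i. ennreal (diameter (U i) powr s)) + ennreal (e * 2)
          \<le> ennreal (2 powr s) * ennreal e + ennreal (e * 2)"
        using U_sum by (intro add_mono mult_left_mono) auto
      also have "\<dots> = ennreal e'"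
        using e by (simp add: e'_def algebra_simps flip: ennreal_mult'' ennreal_plus)
      finally show ?thesis using e by (simp add: e'_def)
    qed
    \<comment> \<open>Each member of class k adds 2^(-ks) to a total of at most \<open>e'\<close>,
      so there are at most e' 2^(ks) of them; in particular the class is finite, as the estimate for
      balls demands.\<close>
    have card_le: "finite {i. m i = k} \<and> real (card {i. m i = k}) * ((1/2) ^ k) powr s \<le> e'" for k
    proof -
      let ?w = "((1/2::real) ^ k) powr s"
      have le: "real (card I) * ?w \<le> e'" if "finite I" "I \<subseteq> {i. m i = k}" for I
      proof -
        have "(\<Sum>i\<in>I. ((1/2) ^ m i) powr s) = (\<Sum>i\<in>I. ?w)"
          using that by (intro sum.cong) auto
        then show ?thesis using total[OF that(1)] by simp
      qed
      have "finite {i. m i = k}"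
      proof (rule ccontr)
        assume "infinite {i. m i = k}"
        then obtain I where "I \<subseteq> {i. m i = k}" "finite I" "card I = Suc (nat \<lceil>e' / ?w\<rceil>)"
          using infinite_arbitrarily_large by blast
        then have "(1 + real (nat \<lceil>e' / ?w\<rceil>)) * ?w \<le> e'" using le[of I] by simp
        moreover have "e' / ?w \<le> real (nat \<lceil>e' / ?w\<rceil>)" by (rule real_nat_ceiling_ge)
        then have "e' / ?w < 1 + real (nat \<lceil>e' / ?w\<rceil>)" by linarith
        then have "e' < (1 + real (nat \<lceil>e' / ?w\<rceil>)) * ?w" by (simp add: divide_less_eq)
        ultimately show False by simp
      qed
      then show ?thesis using le by blast
    qed
    \<comment> \<open>Sets that miss \<open>space \<mu>\<close> are dropped, because the balls must
      have their centres in the space.\<close>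
    define I where "I k = {i. m i = k \<and> U i \<inter> space \<mu> \<noteq> {}}" for k
    define x where "x i = (SOME y. y \<in> U i \<inter> space \<mu>)" for i
    have x: "x i \<in> U i \<inter> space \<mu>" if "i \<in> I k" for i k
    proof -
      have "\<exists>y. y \<in> U i \<inter> space \<mu>" using that by (auto simp: I_def)
      then show ?thesis unfolding x_def by (rule someI_ex)
    qed
    have I: "finite (I k)" "card (I k) \<le> card {i. m i = k}" for k
    proof -
      have "I k \<subseteq> {i. m i = k}" by (auto simp: I_def)
      then show "finite (I k)" "card (I k) \<le> card {i. m i = k}"
        using card_le[of k] by (auto intro: card_mono finite_subset)
    qed
    define G where "G k = (\<Union>y\<in>x ` I k. cball y ((1/2) ^ k)) \<inter> space \<mu>" for k
    have G: "G k \<in> sets \<mu> \<and> measure \<mu> (G k) \<le> sqrt (M * real (card (x ` I k)) * ((1/2) ^ k) powr t)" for k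
      unfolding G_def by (rule balls) (use I x in \<open>auto simp: power_le_one\<close>)
    \<comment> \<open>Inserting the class size leaves (M e' 2^(-k(t-s)))^(1/2): the sum over k
      converges because s < t.\<close>
    have G_le: "measure \<mu> (G k) \<le> sqrt (M * e') * q ^ k" for k
    proof -
      have "real (card (x ` I k)) \<le> real (card {i. m i = k})"
        using card_image_le[OF I(1)[of k], of x] I(2)[of k] by simp
      then have "real (card (x ` I k)) * ((1/2) ^ k) powr s \<le> e'"
        using card_le[of k] by (meson mult_right_mono order_trans powr_ge_zero)
      then have "real (card (x ` I k)) * ((1/2) ^ k) powr s * ((1/2) ^ k) powr (t - s) \<le> e' * ((1/2) ^ k) powr (t - s)"
        by (rule mult_right_mono) simp
      also have "real (card (x ` I k)) * ((1/2) ^ k) powr s * ((1/2) ^ k) powr (t - s)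
          = real (card (x ` I k)) * ((1/2) ^ k) powr t"
        by (simp add: mult.assoc flip: powr_add)
      also have "((1/2::real) ^ k) powr (t - s) = ((1/2) powr (t - s)) ^ k"
        by (simp add: powr_realpow[symmetric] powr_powr mult.commute)
      finally have "M * (real (card (x ` I k)) * ((1/2) ^ k) powr t) \<le> M * (e' * ((1/2) powr (t - s)) ^ k)"
        using M by (rule mult_left_mono)
      then have "sqrt (M * real (card (x ` I k)) * ((1/2) ^ k) powr t) \<le> sqrt (M * e' * ((1/2) powr (t - s)) ^ k)"
        by (simp add: mult.assoc)
      also have "\<dots> = sqrt (M * e') * q ^ k"
        by (simp add: q_def real_sqrt_mult real_sqrt_power)
      finally show ?thesis using G[of k] by linarith
    qed
    have sub: "E \<subseteq> (\<Union>k. G k)"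
    proof
      fix y assume y: "y \<in> E"
      then obtain i where i: "y \<in> U i" using U by blast
      have y_sp: "y \<in> space \<mu>" using y E sets.sets_into_space by blast
      then have iI: "i \<in> I (m i)" using i by (auto simp: I_def)
      have "dist (x i) y \<le> diameter (U i)"
        using x[OF iI] i U(2) by (intro diameter_bounded_bound) auto
      then have "y \<in> G (m i)"
        using m[of i] iI y_sp by (auto simp: G_def intro!: bexI[of _ i])
      then show "y \<in> (\<Union>k. G k)" by blast
    qed
    have "emeasure \<mu> E \<le> emeasure \<mu> (\<Union>k. G k)"
      using G by (intro emeasure_mono[OF sub]) auto
    also have "\<dots> \<le> (\<Sum>k. emeasure \<mu> (G k))"
      using G by (intro emeasure_subadditive_countably) auto
    also have "\<dots> \<le> (\<Sum>k. ennreal (sqrt (M * e') * q ^ k))"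
      using G_le by (intro suminf_le) (auto simp: emeasure_eq_measure intro: ennreal_leI)
    also have "\<dots> = ennreal (sqrt (M * e') * (1 / (1 - q)))"
      using q M e geometric_sums[of q]
      by (intro suminf_ennreal_eq sums_mult) (auto simp: e'_def)
    finally have "measure \<mu> E \<le> sqrt (M * e') * (1 / (1 - q))"
      using q M e by (simp add: emeasure_eq_measure e'_def)
    then show ?thesis by (simp add: e'_def)
  qed
  have "measure \<mu> E \<le> 0"
  proof (rule LIMSEQ_le_const)
    have "(\<lambda>n. sqrt (M * ((2 powr s + 2) * inverse (real (Suc n)))) / (1 - q))
        \<longlonglongrightarrow> sqrt (M * ((2 powr s + 2) * 0)) / (1 - q)"
      using q by (intro tendsto_intros LIMSEQ_inverse_real_of_nat) auto
    then show "(\<lambda>n. sqrt (M * ((2 powr s + 2) * inverse (real (Suc n)))) / (1 - q)) \<longlonglongrightarrow> 0"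
      by simp
    show "\<exists>N. \<forall>n\<ge>N. measure \<mu> E \<le> sqrt (M * ((2 powr s + 2) * inverse (real (Suc n)))) / (1 - q)"
      using bound by (intro exI[of _ 0] allI impI) simp
  qed
  then show ?thesis by (simp add: emeasure_eq_measure measure_le_0_iff)
qed

section \<open>The lower bound for the dimension\<close>

theorem corollary3p3:
  fixes R :: "nat \<Rightarrow> complex ^ 'n::finite \<Rightarrow> complex"
    and J :: "nat \<Rightarrow> nat"
    and a :: "nat \<Rightarrow> complex"
    and \<mu> :: "(complex ^ 'n) measure"
  assumes "CARD('n) \<ge> 2"
    and "Riesz_triple R J a"
    and "is_Riesz_product R J a \<mu>"
  shows "hausdorff_dim_measure \<mu> \<ge> ereal (2 * real CARD('n) - 1) - alpha0 J a"
proof -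
  interpret riesz_triple R J a by standard fact
  let ?d = "2 * real CARD('n) - 1"
  have sets_\<mu>: "sets \<mu> = sets (sphere_measure :: (complex ^ 'n) measure)"
    using assms(3) by (simp add: is_Riesz_product_def sets_sphere_measure)
  have space_\<mu>: "space \<mu> = usphere"
    using sets_eq_imp_space_eq[OF sets_\<mu>] by (simp only: space_sphere_measure)
  have null: "emeasure \<mu> E = 0"
    if E: "E \<in> sets \<mu>" and s: "s > 0" "hausdorff_outer_measure s E = 0"
      and less: "ereal s < ereal ?d - alpha0 J a" for E s
  proof -
    have nonneg: "alpha0 J a \<ge> 0" by (simp add: alpha0_def)
    \<comment> \<open>If \<open>alpha0 J a\<close> were \<infinity>, then \<open>less\<close> would
      put s below -\<infinity>.\<close>
    have "alpha0 J a < ereal (?d - s)"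
      using less nonneg by (cases "alpha0 J a") auto
    then obtain \<alpha>' where \<alpha>': "alpha0 J a < \<alpha>'" "\<alpha>' < ereal (?d - s)" using dense by blast
    then obtain \<alpha> where \<alpha>: "alpha0 J a < ereal \<alpha>" "\<alpha> < ?d - s"
      using nonneg by (cases \<alpha>') auto
    have "ereal 0 < ereal \<alpha>" using nonneg \<alpha>(1) by (simp only: zero_ereal_def[symmetric])
    then have \<alpha>_pos: "\<alpha> > 0" by simp
    \<comment> \<open>The cap keeps the exponent in the range of the multiplier estimate. Lowering
      \<alpha> only raises \<open>?d - \<beta>\<close>, so s stays below it, and summability at
      exponent 1 is automatic.\<close>
    define \<beta> where "\<beta> = min \<alpha> 1"
    have \<beta>: "0 < \<beta>" "\<beta> \<le> 2" "\<beta> \<le> \<alpha>" using \<alpha>_pos by (auto simp: \<beta>_def)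
    have sum: "summable (\<lambda>k. riesz_block a k * real (J k) powr - \<beta>)"
    proof (cases "\<alpha> \<le> 1")
      case True
      then show ?thesis using summable_riesz_block[of J a \<alpha>] J_pos J_lac \<alpha>(1) by (simp add: \<beta>_def)
    next
      case False
      then show ?thesis using summable_riesz_block_one[of J a] J_pos J_lac a_less by (simp add: \<beta>_def)
    qed
    let ?M = "4 * 2 ^ (2 * CARD('n)) * 3 ^ (2 * CARD('n) - 1) * energy_const \<beta>"
    show ?thesis
    proof (rule hausdorff_null_imp_null[where s=s and t="?d - \<beta>" and M="?M"])
      show "finite_measure \<mu>"
        using assms(3) by (simp add: is_Riesz_product_def prob_space_def)
      fix X :: "(complex ^ 'n) set" and r :: real
      assume X: "finite X" "X \<subseteq> space \<mu>" and r: "0 < r" "r \<le> 1"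
      have "(\<Union>x\<in>X. cball x r) \<inter> usphere \<in> sets \<mu>"
        unfolding sets_\<mu> sets_sphere_measure_iff using X
        by (auto intro!: sets.Int borel_closed closed_UN)
      then show "(\<Union>x\<in>X. cball x r) \<inter> space \<mu> \<in> sets \<mu> \<and>
          measure \<mu> ((\<Union>x\<in>X. cball x r) \<inter> space \<mu>) \<le> sqrt (?M * real (card X) * r powr (?d - \<beta>))"
        using measure_Riesz_product_balls_le[OF assms(3) \<beta>(1,2) r sum X(1)] X(2)
        by (simp add: space_\<mu>)
    qed (use s E \<beta> \<alpha> energy_const_pos[OF sum] in auto)
  qed
  show ?thesis
    unfolding hausdorff_dim_measure_def hausdorff_dim_def
  proof (intro INF_greatest)
    fix E s assume "E \<in> {E \<in> sets \<mu>. 0 < emeasure \<mu> E}" "s \<in> {s. 0 < s \<and> hausdorff_outer_measure s E = 0}"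
    then show "ereal ?d - alpha0 J a \<le> ereal s"
      using null[of E s] by (intro leI notI) auto
  qed
qed

end
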